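(* Let $(G,\Gamma)$ be a minimally rigid $d$-periodic graph with $n=|V/\Gamma|$ and $m=|E/\Gamma|=nd+\binom{d}{2}$. Let $\mu$ be the number of cubic edge constraints, i.e. the number of edge orbits in $E/\Gamma$ whose representative $e_{ij}=(v_i,v_j+\gamma_{ij})$ has $i\neq j$. Then $$dn-d\le\mu\le m,$$ and $(G,\Gamma)$ has at most $3^{\mu}$ non-congruent configurations in $\mathbb{R}^d$ for a generic prescription of edge lengths. That is, for all $c$ in the complement of some proper algebraic subset of $\mathbb{R}^m$, there are at most $3^\mu$ classes, modulo the isometry group $E(d)$, of periodic placements of $(G,\Gamma)$ in $\mathbb{R}^d$ whose vector of squared edge lengths is $c$; equivalently, the fiber $f^{-1}(c)\subset(\mathbb{R}^d)^{n-1}\times\Omega(d)$ has at most $3^\mu$ points.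
   Context: A $d$-periodic graph $(G,\Gamma)$ consists of an infinite connected graph $G=(V,E)$ and a free Abelian group $\Gamma\subset Aut(G)$ of rank $d$, acting freely on $V$ (action written $\gamma v=v+\gamma$), such that the quotient multigraph $G/\Gamma$ is finite. A periodic placement $(p,\pi)$ of $(G,\Gamma)$ in $\mathbb{R}^d$ consists of a function $p:V\to\mathbb{R}^d$ and an injective homomorphism $\pi:\Gamma\to\mathcal{T}(\mathbb{R}^d)$ into the group of translations of $\mathbb{R}^d$ (identified with $\mathbb{R}^d$), whose image is a lattice of rank $d$, such that $p\circ\gamma=\pi(\gamma)\circ p$ for all $\gamma\in\Gamma$. Two placements are congruent if they differ by an isometry $u\in E(d)$, $u(x)=Ux+t$ with $U\in O(d,\mathbb{R})$, acting by $(p,\pi)\mapsto(u\circ p,U\pi)$. Fix representatives $v_0,\dots,v_{n-1}$ of the $\Gamma$-orbits on $V$, an isomorphism $\mathbb{Z}^d\approx\Gamma$, and representatives of the $m$ edge orbits $E/\Gamma$ of the form $e_{ij}=(v_i,v_j+\gamma_{ij})$ with $\gamma_{ij}\in\Gamma$ (several edge representatives may share the same pair $i,j$); let $n_{ij}\in\mathbb{Z}^d$ correspond to $\gamma_{ij}$. Let $\Omega(d)$ be the open cone of positive definite real symmetric $d\times d$ matrices. Congruence classes of periodic placements correspond bijectively to points $(t_1,\dots,t_{n-1},\omega)\in(\mathbb{R}^d)^{n-1}\times\Omega(d)$ via $t_i=\Lambda^{-1}(p(v_i)-p(v_0))$ and $\omega=\Lambda^t\Lambda$, where $\Lambda\in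 GL(d,\mathbb{R})$ has columns $\pi(e_1),\dots,\pi(e_d)$ ($e_k$ the standard basis of $\mathbb{Z}^d\approx\Gamma$). In these parameters, with $t_0=0$, the squared length of the edge $e_{ij}$ is $\|p(v_j+\gamma_{ij})-p(v_i)\|^2=(t_j+n_{ij}-t_i)^t\omega(t_j+n_{ij}-t_i)$. The squared edge length map is the polynomial map $$f:(\mathbb{R}^d)^{n-1}\times\Omega(d)\to\mathbb{R}^m,\qquad f(t_1,\dots,t_{n-1},\omega)=\big((t_j+n_{ij}-t_i)^t\omega(t_j+n_{ij}-t_i)\big)_{ij},$$ with one component for each chosen edge representative; the component is cubic if $i\ne j$ and linear if $i=j$. $(G,\Gamma)$ is minimally rigid if $m=dn+\binom{d}{2}$ and, at generic placements, the $m$ edge length constraints are independent, i.e. the differential of $f$ has rank $m$ at generic points of $(\mathbb{R}^d)^{n-1}\times\Omega(d)$. *)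

theory Defs
  imports
    "HOL-Analysis.Analysis"
    "HOL-Algebra.Free_Abelian_Groups"
    "HOL-Algebra.Group_Action"
begin

section \<open>Periodic graphs\<close>

text \<open>
  Graphs are simple and undirected, given by a vertex set \<open>V\<close> and a set \<open>E\<close> of
  two-element subsets of \<open>V\<close>.
\<close>

definition simple_graph :: "'v set \<Rightarrow> 'v set set \<Rightarrow> bool" where
  "simple_graph V E \<longleftrightarrow> (\<forall>e\<in>E. e \<subseteq> V \<and> card e = 2)"

definition graph_connected :: "'v set \<Rightarrow> 'v set set \<Rightarrow> bool" where
  "graph_connected V E \<longleftrightarrow> (\<forall>u\<in>V. \<forall>w\<in>V. (u, w) \<in> {(x, y). {x, y} \<in> E}\<^sup>*)"

definition graph_automorphisms :: "'v set \<Rightarrow> 'v set set \<Rightarrow> ('v \<Rightarrow> 'v) set" where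
  "graph_automorphisms V E =
     {g \<in> Bij V. \<forall>u\<in>V. \<forall>w\<in>V. {g u, g w} \<in> E \<longleftrightarrow> {u, w} \<in> E}"

definition perm_group :: "'v set \<Rightarrow> ('v \<Rightarrow> 'v) set \<Rightarrow> ('v \<Rightarrow> 'v) monoid" where
  "perm_group V \<Gamma> = BijGroup V \<lparr>carrier := \<Gamma>\<rparr>"

definition vertex_orbits :: "'v set \<Rightarrow> ('v \<Rightarrow> 'v) set \<Rightarrow> 'v set set" where
  "vertex_orbits V \<Gamma> = orbits (perm_group V \<Gamma>) V (\<lambda>g. g)"

definition edge_orbits :: "'v set \<Rightarrow> 'v set set \<Rightarrow> ('v \<Rightarrow> 'v) set \<Rightarrow> 'v set set set" where
  "edge_orbits V E \<Gamma> = orbits (perm_group V \<Gamma>) E image"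

definition periodic_graph :: "nat \<Rightarrow> 'v set \<Rightarrow> 'v set set \<Rightarrow> ('v \<Rightarrow> 'v) set \<Rightarrow> bool" where
  "periodic_graph d V E \<Gamma> \<longleftrightarrow>
     simple_graph V E \<and> infinite V \<and> graph_connected V E \<and>
     subgroup \<Gamma> (BijGroup V) \<and> \<Gamma> \<subseteq> graph_automorphisms V E \<and>
     perm_group V \<Gamma> \<cong> free_Abelian_group {..<d} \<and>
     (\<forall>g\<in>\<Gamma>. \<forall>x\<in>V. g x = x \<longrightarrow> g = \<one>\<^bsub>BijGroup V\<^esub>) \<and>
     finite (vertex_orbits V \<Gamma>) \<and> finite (edge_orbits V E \<Gamma>)"


section \<open>Choice of coordinates\<close>

text \<open>
  Vectors in dimension \<open>d\<close> have the index type \<open>'d\<close>; the finite types \<open>'n\<close> and \<open>'m\<close> index the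
  chosen representatives of the vertex and edge orbits, hence stand for \<open>{0..n-1}\<close> and for
  the \<open>m\<close> edge orbits. An edge representative \<open>e\<close> joins \<open>v (src e)\<close> to the translate of
  \<open>v (tgt e)\<close> by the group element with coordinates \<open>sh e\<close>.
\<close>

definition additive_group :: "'a::ab_group_add monoid" where
  "additive_group = \<lparr>carrier = UNIV, monoid.mult = (+), one = 0\<rparr>"

definition lattice_coordinates ::
  "'v set \<Rightarrow> ('v \<Rightarrow> 'v) set \<Rightarrow> (int ^ 'd \<Rightarrow> 'v \<Rightarrow> 'v) \<Rightarrow> bool" where
  "lattice_coordinates V \<Gamma> \<phi> \<longleftrightarrow> \<phi> \<in> iso additive_group (perm_group V \<Gamma>)"

definition vertex_representatives ::
  "'v set \<Rightarrow> ('v \<Rightarrow> 'v) set \<Rightarrow> ('n::finite \<Rightarrow> 'v) \<Rightarrow> bool" where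
  "vertex_representatives V \<Gamma> v \<longleftrightarrow>
     range v \<subseteq> V \<and>
     bij_betw (\<lambda>i. orbit (perm_group V \<Gamma>) (\<lambda>g. g) (v i)) UNIV (vertex_orbits V \<Gamma>)"

definition edge_representatives ::
  "'v set \<Rightarrow> 'v set set \<Rightarrow> ('v \<Rightarrow> 'v) set \<Rightarrow> (int ^ 'd \<Rightarrow> 'v \<Rightarrow> 'v) \<Rightarrow> ('n::finite \<Rightarrow> 'v) \<Rightarrow>
   ('m::finite \<Rightarrow> 'n) \<Rightarrow> ('m \<Rightarrow> 'n) \<Rightarrow> ('m \<Rightarrow> int ^ 'd) \<Rightarrow> bool" where
  "edge_representatives V E \<Gamma> \<phi> v src tgt sh \<longleftrightarrow>
     (\<forall>e. {v (src e), \<phi> (sh e) (v (tgt e))} \<in> E) \<and>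
     bij_betw (\<lambda>e. orbit (perm_group V \<Gamma>) image {v (src e), \<phi> (sh e) (v (tgt e))})
       UNIV (edge_orbits V E \<Gamma>)"

definition num_cubic :: "('m::finite \<Rightarrow> 'n) \<Rightarrow> ('m \<Rightarrow> 'n) \<Rightarrow> nat" where
  "num_cubic src tgt = card {e. src e \<noteq> tgt e}"


section \<open>Periodic placements and congruence\<close>

text \<open>Translations are identified with vectors.\<close>

definition full_rank_lattice :: "(real ^ 'd) set \<Rightarrow> bool" where
  "full_rank_lattice L \<longleftrightarrow>
     (\<exists>b :: 'd \<Rightarrow> real ^ 'd. inj b \<and> independent (range b) \<and>
        L = range (\<lambda>a :: 'd \<Rightarrow> int. \<Sum>k\<in>UNIV. of_int (a k) *\<^sub>R b k))"

definition periodic_placements ::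
  "'v set \<Rightarrow> ('v \<Rightarrow> 'v) set \<Rightarrow> (('v \<Rightarrow> real ^ 'd) \<times> (('v \<Rightarrow> 'v) \<Rightarrow> real ^ 'd)) set" where
  "periodic_placements V \<Gamma> =
     {(p, \<pi>). \<pi> \<in> hom (perm_group V \<Gamma>) additive_group \<and> inj_on \<pi> \<Gamma> \<and>
        full_rank_lattice (\<pi> ` \<Gamma>) \<and> (\<forall>g\<in>\<Gamma>. \<forall>x\<in>V. p (g x) = p x + \<pi> g)}"

text \<open>
  Placements are only meaningful on \<open>V\<close> and \<open>\<Gamma>\<close>; comparing them only there makes the
  irrelevant values of the total functions \<open>p\<close> and \<open>\<pi>\<close> disappear in the quotient.
\<close>

definition congruence ::
  "'v set \<Rightarrow> ('v \<Rightarrow> 'v) set \<Rightarrow> (('v \<Rightarrow> real ^ 'd) \<times> (('v \<Rightarrow> 'v) \<Rightarrow> real ^ 'd)) rel" where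
  "congruence V \<Gamma> =
     {((p, \<pi>), (p', \<pi>')).
        (p, \<pi>) \<in> periodic_placements V \<Gamma> \<and> (p', \<pi>') \<in> periodic_placements V \<Gamma> \<and>
        (\<exists>U t. orthogonal_matrix U \<and>
           (\<forall>x\<in>V. p' x = U *v p x + t) \<and> (\<forall>g\<in>\<Gamma>. \<pi>' g = U *v \<pi> g))}"

definition squared_lengths ::
  "(int ^ 'd \<Rightarrow> 'v \<Rightarrow> 'v) \<Rightarrow> ('n::finite \<Rightarrow> 'v) \<Rightarrow> ('m::finite \<Rightarrow> 'n) \<Rightarrow> ('m \<Rightarrow> 'n) \<Rightarrow>
   ('m \<Rightarrow> int ^ 'd) \<Rightarrow> ('v \<Rightarrow> real ^ 'd) \<Rightarrow> real ^ 'm" where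
  "squared_lengths \<phi> v src tgt sh p =
     (\<chi> e. (norm (p (\<phi> (sh e) (v (tgt e))) - p (v (src e))))\<^sup>2)"

definition placements_with_lengths ::
  "'v set \<Rightarrow> ('v \<Rightarrow> 'v) set \<Rightarrow> (int ^ 'd \<Rightarrow> 'v \<Rightarrow> 'v) \<Rightarrow> ('n::finite \<Rightarrow> 'v) \<Rightarrow>
   ('m::finite \<Rightarrow> 'n) \<Rightarrow> ('m \<Rightarrow> 'n) \<Rightarrow> ('m \<Rightarrow> int ^ 'd) \<Rightarrow> real ^ 'm \<Rightarrow>
   (('v \<Rightarrow> real ^ 'd) \<times> (('v \<Rightarrow> 'v) \<Rightarrow> real ^ 'd)) set" where
  "placements_with_lengths V \<Gamma> \<phi> v src tgt sh c =
     {(p, \<pi>) \<in> periodic_placements V \<Gamma>. squared_lengths \<phi> v src tgt sh p = c}"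


section \<open>The squared edge length map\<close>

text \<open>
  The parameter space \<open>(\<real>^d)^(n-1) \<times> \<Omega>(d)\<close> is realised as the set of pairs \<open>(t, \<omega>)\<close> with
  \<open>t $ i0 = 0\<close>, where \<open>i0\<close> is the index of the base vertex. It is a relatively open subset of the
  linear space \<open>parameter_tangent i0\<close>, which is therefore its tangent space at every point.
\<close>

definition positive_definite :: "real ^ 'd ^ 'd \<Rightarrow> bool" where
  "positive_definite \<omega> \<longleftrightarrow> transpose \<omega> = \<omega> \<and> (\<forall>x. x \<noteq> 0 \<longrightarrow> x \<bullet> (\<omega> *v x) > 0)"

definition parameter_space :: "'n::finite \<Rightarrow> (((real ^ 'd) ^ 'n) \<times> (real ^ 'd ^ 'd)) set" where
  "parameter_space i0 = {(t, \<omega>). t $ i0 = 0 \<and> positive_definite \<omega>}"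

definition parameter_tangent :: "'n::finite \<Rightarrow> (((real ^ 'd) ^ 'n) \<times> (real ^ 'd ^ 'd)) set" where
  "parameter_tangent i0 = {(t, \<omega>). t $ i0 = 0 \<and> transpose \<omega> = \<omega>}"

definition edge_vector ::
  "('m::finite \<Rightarrow> 'n::finite) \<Rightarrow> ('m \<Rightarrow> 'n) \<Rightarrow> ('m \<Rightarrow> int ^ 'd) \<Rightarrow> (real ^ 'd) ^ 'n \<Rightarrow> 'm \<Rightarrow> real ^ 'd"
  where "edge_vector src tgt sh t e = t $ tgt e + (\<chi> k. real_of_int (sh e $ k)) - t $ src e"

definition squared_length_map ::
  "('m::finite \<Rightarrow> 'n::finite) \<Rightarrow> ('m \<Rightarrow> 'n) \<Rightarrow> ('m \<Rightarrow> int ^ 'd) \<Rightarrow>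
   ((real ^ 'd) ^ 'n) \<times> (real ^ 'd ^ 'd) \<Rightarrow> real ^ 'm" where
  "squared_length_map src tgt sh =
     (\<lambda>(t, \<omega>). \<chi> e. edge_vector src tgt sh t e \<bullet> (\<omega> *v edge_vector src tgt sh t e))"

text \<open>
  The formula above makes sense on the whole ambient space; the differential of the map on the
  parameter space is the restriction of the ambient derivative to the tangent space.
\<close>

definition differential_rank ::
  "'n::finite \<Rightarrow> ('m::finite \<Rightarrow> 'n) \<Rightarrow> ('m \<Rightarrow> 'n) \<Rightarrow> ('m \<Rightarrow> int ^ 'd) \<Rightarrow>
   ((real ^ 'd) ^ 'n) \<times> (real ^ 'd ^ 'd) \<Rightarrow> nat" where
  "differential_rank i0 src tgt sh z =
     dim (frechet_derivative (squared_length_map src tgt sh) (at z) ` parameter_tangent i0)"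


section \<open>Genericity and minimal rigidity\<close>

definition algebraic_set :: "'a::euclidean_space set \<Rightarrow> bool" where
  "algebraic_set A \<longleftrightarrow>
     (\<exists>P. (\<forall>q\<in>P. real_polynomial_function q) \<and> A = {x. \<forall>q\<in>P. q x = 0})"

text \<open>
  A property is generic on \<open>S\<close> if it holds on \<open>S\<close> outside a proper algebraic subset of \<open>S\<close>.
\<close>

definition generically_on :: "'a::euclidean_space set \<Rightarrow> ('a \<Rightarrow> bool) \<Rightarrow> bool" where
  "generically_on S Q \<longleftrightarrow> (\<exists>A. algebraic_set A \<and> \<not> S \<subseteq> A \<and> (\<forall>x\<in>S - A. Q x))"

definition minimally_rigid ::
  "'v set \<Rightarrow> 'v set set \<Rightarrow> ('v \<Rightarrow> 'v) set \<Rightarrow> 'n::finite \<Rightarrow> ('m::finite \<Rightarrow> 'n) \<Rightarrow> ('m \<Rightarrow> 'n) \<Rightarrow>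
   ('m \<Rightarrow> int ^ 'd) \<Rightarrow> bool" where
  "minimally_rigid V E \<Gamma> i0 src tgt sh \<longleftrightarrow>
     card (edge_orbits V E \<Gamma>) = CARD('d) * card (vertex_orbits V \<Gamma>) + (CARD('d) choose 2) \<and>
     generically_on (parameter_space i0)
       (\<lambda>z. differential_rank i0 src tgt sh z = card (edge_orbits V E \<Gamma>))"

end

theory Submission
  imports Defs "HOL-Real_Asymp.Real_Asymp"
begin

text \<open>
  After parametrising the symmetric matrices and the normalised translations by \<open>\<real>^m\<close>, the squared
  length map becomes a polynomial map \<open>f\<close> from \<open>\<real>^m\<close> to itself with \<open>\<mu>\<close> components of degree 3
  and all others of degree 1. The bound on generic fibres is an elementary form of Bezout's theorem.
  If polynomials \<open>g\<^sub>1, \<dots>, g\<^sub>r\<close> of degree at most \<open>\<delta>\<close> are linearly independent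
  over \<open>\<real>[f]\<close>, then the products of the
  \<open>g\<^sub>k\<close> with the monomials in \<open>f\<close> of weighted degree at most \<open>K\<close> are linearly independent over \<open>\<real>\<close>;
  comparing their number with the dimension of the space of polynomials of degree at most \<open>K + \<delta>\<close>
  for large \<open>K\<close> gives \<open>r \<le> M\<close>, where \<open>M\<close> is the product of the degrees. Hence the monomials of
  degree at most \<open>M\<close> are, up to denominators in \<open>\<real>[f]\<close>, combinations of at most \<open>M\<close> of them. On a
  fibre over a point where no denominator vanishes, all polynomials of degree at most \<open>M\<close> therefore
  restrict to a space of dimension at most \<open>M\<close>, whereas on \<open>M + 1\<close> distinct points they
  interpolate everything. The lower bound on \<open>\<mu>\<close> holds since the loop constraints depend on
  \<open>\<omega>\<close> only, so at most \<open>dim \<Omega>(d)\<close> of them are independent.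
\<close>

section \<open>Homogeneous linear systems\<close>

text \<open>Elimination of one equation at a time: an equation in which some unknown
  \<open>j0\<close> really occurs is solved for it, which leaves one equation and one unknown fewer.
  It serves below for coefficients of polynomials, for values at points and for loop
  constraints.\<close>

lemma homogeneous_system_nontrivial:
  fixes c :: "'j \<Rightarrow> 'b \<Rightarrow> 'a::field"
  assumes "finite B" "finite J" "card B < card J"
  shows "\<exists>u. (\<exists>j\<in>J. u j \<noteq> 0) \<and> (\<forall>b\<in>B. (\<Sum>j\<in>J. u j * c j b) = 0)"
  using assms
proof (induction B arbitrary: J c rule: finite_induct)
  case empty
  then have "J \<noteq> {}" by auto
  then show ?case by (intro exI[of _ "\<lambda>_. 1"]) auto
next
  case (insert b B)
  show ?case
  proof (cases "\<forall>j\<in>J. c j b = 0")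
    case True
    have "card B < card J" using insert.prems insert.hyps by simp
    from insert.IH[OF insert.prems(1) this, of c] obtain u where
      "\<exists>j\<in>J. u j \<noteq> 0" "\<forall>b\<in>B. (\<Sum>j\<in>J. u j * c j b) = 0" by blast
    with True show ?thesis by (intro exI[of _ u]) simp
  next
    case False
    then obtain j0 where j0: "j0 \<in> J" "c j0 b \<noteq> 0" by blast
    define J' where "J' = J - {j0}"
    have J': "finite J'" "J = insert j0 J'" "j0 \<notin> J'"
      using j0 insert.prems by (auto simp: J'_def)
    have "card B < card J'"
      using insert.prems insert.hyps J' by simp
    from insert.IH[OF J'(1) this, of "\<lambda>j b'. c j b' - c j b / c j0 b * c j0 b'"]
    obtain u where u: "\<exists>j\<in>J'. u j \<noteq> 0"
      "\<And>b'. b' \<in> B \<Longrightarrow> (\<Sum>j\<in>J'. u j * (c j b' - c j b / c j0 b * c j0 b')) = 0"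
      by blast
    \<comment> \<open>Back substitution: \<open>w j0\<close> is the value that equation
      \<open>b\<close> forces on the eliminated unknown.\<close>
    define w where "w = u(j0 := - (\<Sum>j\<in>J'. u j * c j b) / c j0 b)"
    have w: "(\<Sum>j\<in>J. w j * c j b') = (\<Sum>j\<in>J'. u j * c j b') - (\<Sum>j\<in>J'. u j * c j b) / c j0 b * c j0 b'" for b'
    proof -
      have "(\<Sum>j\<in>J'. w j * c j b') = (\<Sum>j\<in>J'. u j * c j b')"
        using J' by (intro sum.cong) (auto simp: w_def)
      then show ?thesis using J' by (simp add: w_def)
    qed
    have "(\<Sum>j\<in>J. w j * c j b') = 0" if "b' \<in> insert b B" for b'
    proof (cases "b' = b")
      case True
      then show ?thesis using j0 by (simp add: w)
    next
      case False
      then have "b' \<in> B" using that by simp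
      from u(2)[OF this] show ?thesis
        unfolding w by (simp add: algebra_simps sum_subtractf sum_distrib_left sum_divide_distrib)
    qed
    moreover have "\<exists>j\<in>J. w j \<noteq> 0"
      using u(1) J' by (auto simp: w_def)
    ultimately show ?thesis by blast
  qed
qed

section \<open>Polynomial functions of bounded degree\<close>

definition exponents :: "nat \<Rightarrow> ('m::finite \<Rightarrow> nat) set" where
  "exponents D = {a. sum a UNIV \<le> D}"

definition monom_fun :: "('m::finite \<Rightarrow> nat) \<Rightarrow> real ^ 'm \<Rightarrow> real" where
  "monom_fun a x = (\<Prod>j\<in>UNIV. x $ j ^ a j)"

lemma exponents_le: "a \<in> exponents D \<Longrightarrow> a j \<le> D"
  unfolding exponents_def using member_le_sum[of j UNIV a] by fastforce

lemma exponents_subset_PiE: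
  "exponents D \<subseteq> (UNIV :: 'm::finite set) \<rightarrow>\<^sub>E {..D}"
  using exponents_le by fastforce

lemma finite_exponents [simp]: "finite (exponents D)"
  by (rule finite_subset[OF exponents_subset_PiE]) (simp add: finite_PiE)

lemma card_exponents_le: "card (exponents D :: ('m::finite \<Rightarrow> nat) set) \<le> (D + 1) ^ CARD('m)"
  using card_mono[OF _ exponents_subset_PiE, of D]
  by (simp add: finite_PiE card_PiE)

lemma exponents_mono: "D \<le> D' \<Longrightarrow> exponents D \<subseteq> exponents D'"
  by (auto simp: exponents_def)

lemma exponents_add:
  "a \<in> exponents D \<Longrightarrow> b \<in> exponents D' \<Longrightarrow> (\<lambda>j. a j + b j) \<in> exponents (D + D')"
  by (simp add: exponents_def sum.distrib)

lemma monom_fun_add: "monom_fun (\<lambda>j. a j + b j) x = monom_fun a x * monom_fun b x"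
  by (simp add: monom_fun_def power_add prod.distrib)

lemma monom_fun_0 [simp]: "monom_fun (\<lambda>_. 0) x = 1"
  by (simp add: monom_fun_def)

lemma monom_fun_single: "monom_fun (\<lambda>i. if i = j then 1 else 0) x = x $ j"
proof -
  have "monom_fun (\<lambda>i. if i = j then 1 else 0) x = (\<Prod>i\<in>UNIV. if i = j then x $ i else 1)"
    unfolding monom_fun_def by (intro prod.cong) auto
  then show ?thesis by simp
qed

text \<open>An upper bound instead of an exact degree, so that cancellation is harmless and the zero
  function needs no convention.\<close>

definition degree_le :: "nat \<Rightarrow> (real ^ 'm::finite \<Rightarrow> real) \<Rightarrow> bool" where
  "degree_le D h \<longleftrightarrow> (\<exists>u. \<forall>x. h x = (\<Sum>a\<in>exponents D. u a * monom_fun a x))"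

lemma degree_le_monom: "a \<in> exponents D \<Longrightarrow> degree_le D (\<lambda>x. k * monom_fun a x)"
  unfolding degree_le_def
  by (intro exI[of _ "\<lambda>b. if b = a then k else 0"]) (simp add: if_distrib if_distribR cong: if_cong)

lemma degree_le_mono:
  assumes "degree_le D h" "D \<le> D'"
  shows "degree_le D' h"
proof -
  obtain u where u: "\<And>x. h x = (\<Sum>a\<in>exponents D. u a * monom_fun a x)"
    using assms(1) unfolding degree_le_def by blast
  have "h x = (\<Sum>a\<in>exponents D'. (if a \<in> exponents D then u a else 0) * monom_fun a x)" for x
    unfolding u by (rule sum.mono_neutral_cong_left) (use exponents_mono[OF assms(2)] in auto)
  then show ?thesis unfolding degree_le_def by (intro exI allI)
qed

lemma degree_le_add:
  assumes "degree_le D g" "degree_le D h"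
  shows "degree_le D (\<lambda>x. g x + h x)"
proof -
  obtain u w where "\<And>x. g x = (\<Sum>a\<in>exponents D. u a * monom_fun a x)"
    "\<And>x. h x = (\<Sum>a\<in>exponents D. w a * monom_fun a x)"
    using assms unfolding degree_le_def by blast
  then have "g x + h x = (\<Sum>a\<in>exponents D. (u a + w a) * monom_fun a x)" for x
    by (simp add: sum.distrib distrib_right)
  then show ?thesis unfolding degree_le_def by (intro exI allI)
qed

lemma degree_le_const: "degree_le D (\<lambda>x. k)"
  using degree_le_monom[of "\<lambda>_. 0" D k] by (simp add: exponents_def)

lemma degree_le_coord: "degree_le 1 (\<lambda>x. x $ j)"
  using degree_le_monom[of "\<lambda>i. if i = j then 1 else 0" 1 1]
  unfolding monom_fun_single by (simp add: exponents_def)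

lemma degree_le_sum: "(\<And>i. i \<in> I \<Longrightarrow> degree_le D (h i)) \<Longrightarrow> degree_le D (\<lambda>x. \<Sum>i\<in>I. h i x)"
  by (induction I rule: infinite_finite_induct) (auto intro: degree_le_const degree_le_add)

lemma degree_le_mult:
  assumes "degree_le D g" "degree_le D' h"
  shows "degree_le (D + D') (\<lambda>x. g x * h x)"
proof -
  obtain u w where "\<And>x. g x = (\<Sum>a\<in>exponents D. u a * monom_fun a x)"
    "\<And>x. h x = (\<Sum>a\<in>exponents D'. w a * monom_fun a x)"
    using assms unfolding degree_le_def by blast
  then have "(\<lambda>x. g x * h x) =
    (\<lambda>x. \<Sum>a\<in>exponents D. \<Sum>b\<in>exponents D'. (u a * w b) * monom_fun (\<lambda>j. a j + b j) x)"
    by (simp add: sum_product monom_fun_add mult_ac)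
  moreover have "degree_le (D + D') \<dots>"
    by (intro degree_le_sum degree_le_monom exponents_add)
  ultimately show ?thesis by simp
qed

lemma degree_le_cmult: "degree_le D h \<Longrightarrow> degree_le D (\<lambda>x. k * h x)"
  using degree_le_mult[OF degree_le_const[of 0 k]] by simp

lemma degree_le_diff:
  assumes "degree_le D g" "degree_le D h"
  shows "degree_le D (\<lambda>x. g x - h x)"
  using degree_le_add[OF assms(1) degree_le_cmult[OF assms(2), of "-1"]] by simp

lemma degree_le_prod:
  "finite I \<Longrightarrow> (\<And>i. i \<in> I \<Longrightarrow> degree_le (D i) (h i)) \<Longrightarrow> degree_le (sum D I) (\<lambda>x. \<Prod>i\<in>I. h i x)"
  by (induction I rule: finite_induct) (auto intro: degree_le_const degree_le_mult)

lemma degree_le_power: "degree_le D h \<Longrightarrow> degree_le (k * D) (\<lambda>x. h x ^ k)"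
  by (induction k) (auto intro: degree_le_const degree_le_mult)

section \<open>Vanishing of real polynomials\<close>

lemma real_polynomial_function_monom_fun: "real_polynomial_function (monom_fun a)"
  unfolding monom_fun_def [abs_def]
  by (intro real_polynomial_function_prod real_polynomial_function_power)
     (auto intro: bounded_linear_vec_nth)

text \<open>Induction on the variables: with the others fixed, the combination is a polynomial in
  the variable \<open>i\<close> that vanishes identically, so its coefficients vanish, and these are
  combinations in the remaining variables. Each coefficient collects exponents with the same value
  at \<open>i\<close>, so these are still told apart by the smaller \<open>J\<close>.\<close>

lemma monom_combination_eq_0_aux:
  fixes u :: "('m::finite \<Rightarrow> nat) \<Rightarrow> real"
  assumes "finite J" "finite A"
    and "\<And>a b. a \<in> A \<Longrightarrow> b \<in> A \<Longrightarrow> (\<forall>j\<in>J. a j = b j) \<Longrightarrow> a = b"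
    and "\<And>x :: 'm \<Rightarrow> real. (\<Sum>a\<in>A. u a * (\<Prod>j\<in>J. x j ^ a j)) = 0"
    and "a \<in> A"
  shows "u a = 0"
  using assms
proof (induction J arbitrary: A a rule: finite_induct)
  case empty
  then have "A = {a}" by blast
  then show ?case using empty.prems(3) by simp
next
  case (insert i J)
  define A' where "A' k = {b \<in> A. b i = k}" for k
  obtain N where N: "\<And>b. b \<in> A \<Longrightarrow> b i \<le> N"
  proof
    show "b i \<le> Max ((\<lambda>b. b i) ` A)" if "b \<in> A" for b
      using insert.prems(1) that by simp
  qed
  have "(\<Sum>b\<in>A' k. u b * (\<Prod>j\<in>J. x j ^ b j)) = 0" for k x
  proof (cases "k \<le> N")
    case True
    \<comment> \<open>Moving only coordinate \<open>i\<close> to \<open>s\<close> and grouping terms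
      by the exponent of \<open>i\<close> turns the hypothesis into an identity in one
      variable.\<close>
    have "(\<Sum>l\<le>N. (\<Sum>b\<in>A' l. u b * (\<Prod>j\<in>J. x j ^ b j)) * s ^ l) = 0" for s
    proof -
      have "(\<Sum>l\<le>N. (\<Sum>b\<in>A' l. u b * (\<Prod>j\<in>J. x j ^ b j)) * s ^ l) =
        (\<Sum>l\<le>N. \<Sum>b\<in>A' l. u b * (\<Prod>j\<in>insert i J. (x(i := s)) j ^ b j))"
      proof (intro sum.cong refl, unfold sum_distrib_right, intro sum.cong refl)
        fix l b assume "b \<in> A' l"
        moreover have "(\<Prod>j\<in>J. (x(i := s)) j ^ b j) = (\<Prod>j\<in>J. x j ^ b j)"
          using insert.hyps by (intro prod.cong) auto
        ultimately show "u b * (\<Prod>j\<in>J. x j ^ b j) * s ^ l =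
            u b * (\<Prod>j\<in>insert i J. (x(i := s)) j ^ b j)"
          using insert.hyps by (simp add: A'_def)
      qed
      also have "\<dots> = (\<Sum>b\<in>A. u b * (\<Prod>j\<in>insert i J. (x(i := s)) j ^ b j))"
        unfolding A'_def using insert.prems(1) N by (intro sum.group) auto
      finally show ?thesis using insert.prems(3) by simp
    qed
    then show ?thesis using True polyfun_eq_0[of "\<lambda>l. (\<Sum>b\<in>A' l. u b * (\<Prod>j\<in>J. x j ^ b j))" N]
      by blast
  next
    case False
    then have "A' k = {}" using N by (auto simp: A'_def)
    then show ?thesis by simp
  qed
  then show ?case
    using insert.prems
    by (intro insert.IH[of "A' (a i)" a]) (auto simp: A'_def)
qed

lemma monom_combination_eq_0:
  assumes "finite A" "\<And>x. (\<Sum>a\<in>A. u a * monom_fun a x) = 0" "a \<in> A"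
  shows "u a = 0"
proof (rule monom_combination_eq_0_aux[of UNIV A])
  show "(\<Sum>a\<in>A. u a * (\<Prod>j\<in>UNIV. x j ^ a j)) = 0" for x
    using assms(2)[of "\<chi> j. x j"] by (simp add: monom_fun_def)
qed (use assms in auto)

lemma real_polynomial_function_finite_zeros:
  fixes q :: "real \<Rightarrow> real"
  assumes "real_polynomial_function q" "q s \<noteq> 0"
  shows "finite {x. q x = 0}"
proof -
  obtain a n where q: "q = (\<lambda>x. \<Sum>i\<le>n. a i * x ^ i)"
    using assms(1) unfolding real_polynomial_function_iff_sum by blast
  have "\<exists>i\<le>n. a i \<noteq> 0"
    using assms(2) unfolding q by (metis (no_types, lifting) atMost_iff mult_zero_left sum.neutral)
  then show ?thesis unfolding q using polyfun_finite_roots[of a n] by blast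
qed

text \<open>On the line from a point \<open>x\<close> that is good for the old polynomials to a
  point \<open>y\<close> that is good for the new one, every polynomial is nonzero at parameter 0 or
  1. Each therefore has finitely many zeros on the line, and some real parameter avoids them
  all.\<close>

lemma real_polynomial_function_common_nonzero:
  fixes q :: "'i \<Rightarrow> 'a::euclidean_space \<Rightarrow> real"
  assumes "finite I" "\<And>i. i \<in> I \<Longrightarrow> real_polynomial_function (q i)" "\<And>i. i \<in> I \<Longrightarrow> \<exists>x. q i x \<noteq> 0"
  shows "\<exists>x. \<forall>i\<in>I. q i x \<noteq> 0"
  using assms
proof (induction I rule: finite_induct)
  case (insert i I)
  then obtain x y where x: "\<forall>i\<in>I. q i x \<noteq> 0" and y: "q i y \<noteq> 0" by (meson insertCI)
  have line: "real_polynomial_function (\<lambda>s. q l (x + s *\<^sub>R (y - x)))" if "l \<in> insert i I" for l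
  proof -
    have "polynomial_function (\<lambda>s::real. x + s *\<^sub>R (y - x))"
      by (intro polynomial_function_add polynomial_function_const polynomial_function_mult
          polynomial_function_bounded_linear bounded_linear_ident)
    from real_polynomial_function_compose[OF this insert.prems(1)[OF that]]
    show ?thesis by (simp add: o_def)
  qed
  have "finite (\<Union>l\<in>insert i I. {s. q l (x + s *\<^sub>R (y - x)) = 0})"
  proof (intro finite_UN_I)
    fix l assume l: "l \<in> insert i I"
    then have "q l (x + (if l \<in> I then 0 else 1) *\<^sub>R (y - x)) \<noteq> 0"
      using x y by auto
    then show "finite {s. q l (x + s *\<^sub>R (y - x)) = 0}"
      using real_polynomial_function_finite_zeros[OF line[OF l]] by blast
  qed (use insert.hyps in auto)
  then obtain s where "s \<notin> (\<Union>l\<in>insert i I. {s. q l (x + s *\<^sub>R (y - x)) = 0})"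
    using infinite_UNIV_char_0[where 'a=real] by (meson UNIV_I ex_new_if_finite)
  then show ?case by blast
qed simp

section \<open>Generic fibres of polynomial maps\<close>

text \<open>Division with remainder by \<open>w j\<close> in every coordinate is injective: there
  are as many remainder tuples as the product of the weights, and the quotient tuple has weighted
  degree at most the degree of the original exponent.\<close>

lemma weighted_exponents_card_le:
  fixes w :: "'m::finite \<Rightarrow> nat"
  assumes w: "\<And>j. w j > 0"
  defines "A \<equiv> \<lambda>K. {a. (\<Sum>j\<in>UNIV. a j * w j) \<le> K}"
  shows "finite (A K)" "card (exponents K :: ('m \<Rightarrow> nat) set) \<le> (\<Prod>j\<in>UNIV. w j) * card (A K)"
proof -
  have "A K \<subseteq> exponents K"
  proof
    fix a assume "a \<in> A K"
    then have "(\<Sum>j\<in>UNIV. a j * w j) \<le> K" by (simp add: A_def)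
    moreover have "sum a UNIV \<le> (\<Sum>j\<in>UNIV. a j * w j)"
      using w by (intro sum_mono) (simp add: Suc_leI)
    ultimately show "a \<in> exponents K" by (simp add: exponents_def)
  qed
  then show fin: "finite (A K)" by (rule finite_subset) simp
  define R where "R = (\<Pi>\<^sub>E j\<in>(UNIV :: 'm set). {..<w j})"
  define split :: "('m \<Rightarrow> nat) \<Rightarrow> ('m \<Rightarrow> nat) \<times> ('m \<Rightarrow> nat)"
    where "split b = ((\<lambda>j. b j mod w j), (\<lambda>j. b j div w j))" for b
  have "inj_on split (exponents K)"
  proof (rule inj_onI)
    fix b b' assume "split b = split b'"
    then have "b j mod w j = b' j mod w j" "b j div w j = b' j div w j" for j
      unfolding split_def by (auto dest: fun_cong)
    then have "b j = b' j" for j by (metis div_mult_mod_eq)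
    then show "b = b'" by blast
  qed
  moreover have "split ` exponents K \<subseteq> R \<times> A K"
  proof (intro image_subsetI)
    fix b :: "'m \<Rightarrow> nat" assume "b \<in> exponents K"
    moreover have "(\<Sum>j\<in>UNIV. b j div w j * w j) \<le> sum b UNIV"
      by (intro sum_mono) simp
    ultimately show "split b \<in> R \<times> A K"
      using w by (auto simp: split_def R_def A_def exponents_def)
  qed
  moreover have "finite (R \<times> A K)" using fin by (simp add: R_def finite_PiE)
  ultimately have "card (exponents K :: ('m \<Rightarrow> nat) set) \<le> card (R \<times> A K)"
    by (metis card_inj_on_le)
  then show "card (exponents K :: ('m \<Rightarrow> nat) set) \<le> (\<Prod>j\<in>UNIV. w j) * card (A K)"
    by (simp add: card_cartesian_product R_def card_PiE)
qed

text \<open>The number of exponents grows only polynomially in \<open>K\<close>. If every step by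
  \<open>\<delta>\<close> enlarged it by the factor \<open>(M + 1) / M\<close>, iteration from 0
  would give exponential growth along the multiples of \<open>\<delta>\<close>.\<close>

lemma exponents_subexponential:
  "\<exists>K. M * card (exponents (K + \<delta>) :: ('m::finite \<Rightarrow> nat) set) <
       (M + 1) * card (exponents K :: ('m \<Rightarrow> nat) set)"
proof (rule ccontr)
  define P where "P K = card (exponents K :: ('m \<Rightarrow> nat) set)" for K
  define n where "n = CARD('m)"
  assume "\<not> ?thesis"
  then have step: "(M + 1) * P K \<le> M * P (K + \<delta>)" for K
    unfolding P_def by (simp add: not_less)
  have "(\<lambda>_. 0) \<in> (exponents K :: ('m \<Rightarrow> nat) set)" for K by (simp add: exponents_def)
  then have P_pos: "P K > 0" for K unfolding P_def by (auto simp: card_gt_0_iff)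
  have "M \<noteq> 0"
  proof
    assume "M = 0"
    with step[of 0] P_pos[of 0] show False by simp
  qed
  then have "M > 0" by simp
  have "(M + 1) ^ k \<le> M ^ k * P (k * \<delta>)" for k
  proof (induction k)
    case 0
    then show ?case using P_pos[of 0] by simp
  next
    case (Suc k)
    have "(M + 1) ^ Suc k \<le> (M + 1) * (M ^ k * P (k * \<delta>))"
      unfolding power_Suc by (intro mult_left_mono Suc.IH) simp
    also have "\<dots> = M ^ k * ((M + 1) * P (k * \<delta>))" by (simp only: mult_ac)
    also have "\<dots> \<le> M ^ k * (M * P (k * \<delta> + \<delta>))" by (intro mult_left_mono step) simp
    finally show ?case by (simp add: mult_ac add.commute)
  qed
  moreover have "P (k * \<delta>) \<le> ((k + 1) * (\<delta> + 1)) ^ n" for k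
    unfolding P_def n_def by (rule order_trans[OF card_exponents_le power_mono]) auto
  ultimately have "(M + 1) ^ k \<le> M ^ k * ((k + 1) * (\<delta> + 1)) ^ n" for k
    by (meson le_trans mult_le_mono2)
  then have "real ((M + 1) ^ k) \<le> real (M ^ k * ((k + 1) * (\<delta> + 1)) ^ n)" for k
    by (rule of_nat_mono)
  then have step2: "(real M + 1) ^ k \<le> real M ^ k * ((real k + 1) * (real \<delta> + 1)) ^ n" for k
    by (simp only: of_nat_power of_nat_mult of_nat_add of_nat_1)
  have le: "((real M + 1) / real M) ^ k \<le> (real \<delta> + 1) ^ n * (real k + 1) ^ n" for k
    using step2[of k] \<open>M > 0\<close>
    by (simp only: power_divide pos_divide_le_eq zero_less_power of_nat_0_less_iff power_mult_distrib mult_ac)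
  define q where "q = (real M + 1) / real M"
  define c where "c = (real \<delta> + 1) ^ n"
  have "q > 1" "c > 0" using \<open>M > 0\<close> by (simp_all add: q_def c_def)
  then have "eventually (\<lambda>k. c * (real k + 1) powr (real n) < q ^ k) at_top"
    by real_asymp
  then obtain k where "c * (real k + 1) powr (real n) < q ^ k"
    by (meson eventually_at_top_linorder order_refl)
  moreover have "(real k + 1) powr (real n) = (real k + 1) ^ n" by (simp add: powr_realpow)
  ultimately show False using le[of k] by (simp add: q_def c_def)
qed

text \<open>
  For \<open>G\<close> nonempty this implies that the components of \<open>f\<close> are algebraically independent, because
  the coefficients \<open>B g\<close> are required to vanish as functions on \<open>\<real>^m\<close>, not just on the image of \<open>f\<close>.
\<close>

definition independent_over_image :: "(real ^ 'm::finite \<Rightarrow> real ^ 'm) \<Rightarrow> (real ^ 'm \<Rightarrow> real) set \<Rightarrow> bool" where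
  "independent_over_image f G \<longleftrightarrow>
     (\<forall>B. (\<forall>g\<in>G. real_polynomial_function (B g)) \<and> (\<forall>x. (\<Sum>g\<in>G. B g (f x) * g x) = 0)
        \<longrightarrow> (\<forall>g\<in>G. \<forall>y. B g y = 0))"

text \<open>With \<open>M + 1\<close> members there would be more products of some \<open>g\<close>
  with a monomial in \<open>f\<close> than monomials of degree at most \<open>K + \<delta>\<close>.
  The resulting linear relation, sorted by \<open>g\<close>, is a relation over polynomials in
  \<open>f\<close>.\<close>

lemma card_independent_over_image_le:
  fixes f :: "real ^ 'm::finite \<Rightarrow> real ^ 'm"
  assumes w: "\<And>j. w j > 0" and f: "\<And>j. degree_le (w j) (\<lambda>x. f x $ j)"
    and G: "finite G" "\<And>g. g \<in> G \<Longrightarrow> degree_le \<delta> g" "independent_over_image f G"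
  shows "card G \<le> (\<Prod>j\<in>UNIV. w j)"
proof (rule ccontr)
  define M where "M = (\<Prod>j\<in>UNIV. w j)"
  assume "\<not> ?thesis"
  then have "M + 1 \<le> card G" by (simp add: M_def)
  obtain K where K: "M * card (exponents (K + \<delta>) :: ('m \<Rightarrow> nat) set) <
       (M + 1) * card (exponents K :: ('m \<Rightarrow> nat) set)"
    using exponents_subexponential by blast
  define A where "A = {a. (\<Sum>j\<in>UNIV. a j * w j) \<le> K}"
  have A: "finite A" "card (exponents K :: ('m \<Rightarrow> nat) set) \<le> M * card A"
    unfolding A_def M_def by (rule weighted_exponents_card_le[OF w])+
  have "M > 0" unfolding M_def by (intro prod_pos) (use w in auto)
  \<comment> \<open>Both estimates carry a factor \<open>M\<close>, the first from the growth of
    \<open>exponents\<close> and the second from the weighted count; it cancels at the end of the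
    chain.\<close>
  have "M * card (exponents (K + \<delta>) :: ('m \<Rightarrow> nat) set) < (M + 1) * (M * card A)"
    using K mult_le_mono2[OF A(2), of "M + 1"] by linarith
  also have "\<dots> = M * ((M + 1) * card A)" by (simp add: algebra_simps)
  also have "\<dots> \<le> M * (card G * card A)"
    using \<open>M + 1 \<le> card G\<close> by (intro mult_le_mono) auto
  finally have card: "card (exponents (K + \<delta>) :: ('m \<Rightarrow> nat) set) < card (G \<times> A)"
    by (simp add: card_cartesian_product)
  have "\<exists>c. \<forall>x. g x * monom_fun a (f x) = (\<Sum>b\<in>exponents (K + \<delta>). c b * monom_fun b x)"
    if "(g, a) \<in> G \<times> A" for g a
  proof -
    have "degree_le (\<Sum>j\<in>UNIV. a j * w j) (\<lambda>x. monom_fun a (f x))"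
      unfolding monom_fun_def by (intro degree_le_prod degree_le_power f) auto
    then have "degree_le K (\<lambda>x. monom_fun a (f x))"
      by (rule degree_le_mono) (use that in \<open>simp add: A_def\<close>)
    then have "degree_le (\<delta> + K) (\<lambda>x. g x * monom_fun a (f x))"
      by (intro degree_le_mult G(2)) (use that in auto)
    then show ?thesis by (simp add: degree_le_def add.commute)
  qed
  then have "\<exists>c. \<forall>x. fst z x * monom_fun (snd z) (f x) =
      (\<Sum>b\<in>exponents (K + \<delta>). c b * monom_fun b x)" if "z \<in> G \<times> A" for z
    using that by (cases z) auto
  then have "\<forall>z\<in>G \<times> A. \<exists>c. \<forall>x. fst z x * monom_fun (snd z) (f x) =
      (\<Sum>b\<in>exponents (K + \<delta>). c b * monom_fun b x)"
    by blast
  from bchoice[OF this] obtain c where c: "\<And>z x. z \<in> G \<times> A \<Longrightarrow> fst z x * monom_fun (snd z) (f x) =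
      (\<Sum>b\<in>exponents (K + \<delta>). c z b * monom_fun b x)"
    by blast
  \<comment> \<open>One unknown for each product, and one equation for each monomial in the
    expansions.\<close>
  from homogeneous_system_nontrivial[OF finite_exponents finite_cartesian_product[OF G(1) A(1)] card, of c]
  obtain u where u: "\<exists>z\<in>G \<times> A. u z \<noteq> 0"
    "\<And>b. b \<in> exponents (K + \<delta>) \<Longrightarrow> (\<Sum>z\<in>G \<times> A. u z * c z b) = 0" by blast
  define B where "B g y = (\<Sum>a\<in>A. u (g, a) * monom_fun a y)" for g y
  have "(\<Sum>g\<in>G. B g (f x) * g x) = 0" for x
  proof -
    have "(\<Sum>g\<in>G. B g (f x) * g x) = (\<Sum>g\<in>G. \<Sum>a\<in>A. u (g, a) * (g x * monom_fun a (f x)))"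
      unfolding B_def sum_distrib_right by (simp add: mult_ac)
    also have "\<dots> = (\<Sum>z\<in>G \<times> A. u z * (fst z x * monom_fun (snd z) (f x)))"
      by (simp add: sum.cartesian_product split_beta)
    also have "\<dots> = (\<Sum>z\<in>G \<times> A. \<Sum>b\<in>exponents (K + \<delta>). u z * c z b * monom_fun b x)"
      by (intro sum.cong refl) (simp add: c sum_distrib_left mult.assoc)
    also have "\<dots> = (\<Sum>b\<in>exponents (K + \<delta>). \<Sum>z\<in>G \<times> A. u z * c z b * monom_fun b x)"
      by (rule sum.swap)
    also have "\<dots> = (\<Sum>b\<in>exponents (K + \<delta>). (\<Sum>z\<in>G \<times> A. u z * c z b) * monom_fun b x)"
      by (simp add: sum_distrib_right)
    also have "\<dots> = 0" using u(2) by simp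
    finally show ?thesis .
  qed
  moreover have "real_polynomial_function (B g)" for g
    unfolding B_def [abs_def]
    by (intro real_polynomial_function_sum A real_polynomial_function.intros(2,4) real_polynomial_function_monom_fun)
  ultimately have "B g y = 0" if "g \<in> G" for g y
    using G(3) that unfolding independent_over_image_def by blast
  then have "u (g, a) = 0" if "g \<in> G" "a \<in> A" for g a
    using monom_combination_eq_0[OF A(1), of "\<lambda>a. u (g, a)" a] that unfolding B_def by blast
  then show False using u(1) by auto
qed

text \<open>A product of affine forms, one for each other point \<open>p\<close> of
  \<open>T\<close>: the form vanishes at \<open>p\<close> and takes the value
  \<open>(p0 - p) \<bullet> (p0 - p)\<close>, which is nonzero, at \<open>p0\<close>.\<close>

lemma degree_le_interpolant:
  fixes p0 :: "real ^ 'm::finite"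
  assumes "finite T" "p0 \<in> T" "card T = Suc D"
  obtains h where "degree_le D h" "h p0 \<noteq> 0" "\<And>p. p \<in> T \<Longrightarrow> p \<noteq> p0 \<Longrightarrow> h p = 0"
proof
  define h where "h x = (\<Prod>p\<in>T - {p0}. (x - p) \<bullet> (p0 - p))" for x
  have "degree_le 1 (\<lambda>x. (x - p) \<bullet> (p0 - p))" for p :: "real ^ 'm"
  proof -
    have "degree_le 1 (\<lambda>x. \<Sum>j\<in>UNIV. (p0 - p) $ j * (x $ j - p $ j))"
      by (intro degree_le_sum degree_le_cmult degree_le_diff degree_le_coord degree_le_const)
    then show ?thesis by (simp add: inner_vec_def mult.commute)
  qed
  then have "degree_le (\<Sum>p\<in>T - {p0}. 1) h"
    unfolding h_def [abs_def] by (intro degree_le_prod) (use assms in auto)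
  then show "degree_le D h" using assms by simp
  show "h p0 \<noteq> 0" using assms by (auto simp: h_def)
  show "h p = 0" if "p \<in> T" "p \<noteq> p0" for p
    unfolding h_def by (rule prod_zero) (use that assms in \<open>auto intro!: bexI[of _ p]\<close>)
qed

text \<open>Take \<open>G\<close> maximal among the independent subsets: adding any further
  \<open>s\<close> creates a relation, whose coefficient at \<open>s\<close> is the denominator
  \<open>q\<close>. That \<open>q\<close> is nonzero as a polynomial on the whole target space,
  possibly off the image of \<open>f\<close>.\<close>

lemma finite_spanning_over_image:
  fixes f :: "real ^ 'm::finite \<Rightarrow> real ^ 'm"
  assumes "finite S"
  shows "\<exists>G. G \<subseteq> S \<and> independent_over_image f G \<and>
    (\<forall>s\<in>S. \<exists>q b. real_polynomial_function q \<and> (\<exists>y. q y \<noteq> 0) \<and>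
        (\<forall>x. q (f x) * s x = (\<Sum>g\<in>G. b g (f x) * g x)))"
proof -
  define \<G> where "\<G> = {G. G \<subseteq> S \<and> independent_over_image f G}"
  have "{} \<in> \<G>" by (simp add: \<G>_def independent_over_image_def)
  moreover have "finite \<G>" unfolding \<G>_def using assms by simp
  ultimately obtain G where G: "G \<in> \<G>" "\<And>G'. G' \<in> \<G> \<Longrightarrow> G \<subseteq> G' \<Longrightarrow> G = G'"
    using finite_has_maximal[of \<G>] by blast
  then have "finite G" using assms by (auto simp: \<G>_def intro: finite_subset)
  have "\<exists>q b. real_polynomial_function q \<and> (\<exists>y. q y \<noteq> 0) \<and>
        (\<forall>x. q (f x) * s x = (\<Sum>g\<in>G. b g (f x) * g x))" if "s \<in> S" for s
  proof (cases "s \<in> G")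
    case True
    have "1 * s x = (\<Sum>g\<in>G. (if g = s then 1 else 0) * g x)" for x
      using True \<open>finite G\<close> by (simp add: if_distrib[of "\<lambda>c. c * _"] sum.delta cong: if_cong)
    then show ?thesis
      by (intro exI[of _ "\<lambda>_. 1"] exI[of _ "\<lambda>g _. if g = s then 1 else 0"]) auto
  next
    case False
    then have "insert s G \<notin> \<G>" using G(2)[of "insert s G"] by blast
    then have "\<not> independent_over_image f (insert s G)"
      using that G(1) by (auto simp: \<G>_def)
    then obtain B where B: "\<And>g. g \<in> insert s G \<Longrightarrow> real_polynomial_function (B g)"
      "\<And>x. (\<Sum>g\<in>insert s G. B g (f x) * g x) = 0" "\<exists>g\<in>insert s G. \<exists>y. B g y \<noteq> 0"
      unfolding independent_over_image_def by blast
    have rel: "B s (f x) * s x = (\<Sum>g\<in>G. - B g (f x) * g x)" for x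
      using B(2)[of x] False \<open>finite G\<close> by (simp add: sum_negf)
    \<comment> \<open>Otherwise the relation would involve only members of \<open>G\<close>, against
      their independence.\<close>
    have "\<exists>y. B s y \<noteq> 0"
    proof (rule ccontr)
      assume 0: "\<nexists>y. B s y \<noteq> 0"
      then have "(\<Sum>g\<in>G. B g (f x) * g x) = 0" for x
        using rel[of x] by (simp add: sum_negf)
      then have "\<forall>g\<in>G. \<forall>y. B g y = 0"
        using G(1) B(1) unfolding \<G>_def independent_over_image_def by blast
      with 0 B(3) show False by blast
    qed
    then show ?thesis using rel B(1)
      by (intro exI[of _ "B s"] exI[of _ "\<lambda>g y. - B g y"]) simp
  qed
  with G(1) show ?thesis unfolding \<G>_def by blast
qed

text \<open>\<open>Q\<close> is the product of the denominators of all monomials in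
  \<open>S\<close>. Algebraically dependent components of \<open>f\<close> fit without a separate
  case: then \<open>G\<close> is empty and \<open>Q\<close> vanishes on the image of
  \<open>f\<close>, so the fibres in question are empty.\<close>

theorem generic_fibre_card_le:
  fixes f :: "real ^ 'm::finite \<Rightarrow> real ^ 'm"
  assumes w: "\<And>j. w j > 0" and f: "\<And>j. degree_le (w j) (\<lambda>x. f x $ j)"
  obtains Q where "real_polynomial_function Q" "\<exists>c. Q c \<noteq> 0"
    "\<And>c. Q c \<noteq> 0 \<Longrightarrow> finite {x. f x = c} \<and> card {x. f x = c} \<le> (\<Prod>j\<in>UNIV. w j)"
proof -
  define M where "M = (\<Prod>j\<in>UNIV. w j)"
  \<comment> \<open>Degree \<open>M\<close> is what interpolation on \<open>M + 1\<close> points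
    requires.\<close>
  define S :: "(real ^ 'm \<Rightarrow> real) set" where "S = monom_fun ` exponents M"
  have "finite S" by (simp add: S_def)
  from finite_spanning_over_image[OF this, of f]
  obtain G where G: "G \<subseteq> S" "independent_over_image f G"
    and "\<forall>s\<in>S. \<exists>q b. real_polynomial_function q \<and> (\<exists>y. q y \<noteq> 0) \<and>
        (\<forall>x. q (f x) * s x = (\<Sum>g\<in>G. b g (f x) * g x))"
    by (elim exE conjE)
  from bchoice[OF this(3)] obtain q where
    "\<forall>s\<in>S. \<exists>b. real_polynomial_function (q s) \<and> (\<exists>y. q s y \<noteq> 0) \<and>
        (\<forall>x. q s (f x) * s x = (\<Sum>g\<in>G. b g (f x) * g x))"
    by (elim exE)
  from bchoice[OF this] obtain b where
    "\<forall>s\<in>S. real_polynomial_function (q s) \<and> (\<exists>y. q s y \<noteq> 0) \<and>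
        (\<forall>x. q s (f x) * s x = (\<Sum>g\<in>G. b s g (f x) * g x))"
    by (elim exE)
  then have q: "\<And>s. s \<in> S \<Longrightarrow> real_polynomial_function (q s)"
    "\<And>s. s \<in> S \<Longrightarrow> \<exists>y. q s y \<noteq> 0"
    "\<And>s x. s \<in> S \<Longrightarrow> q s (f x) * s x = (\<Sum>g\<in>G. b s g (f x) * g x)"
    by blast+
  have "finite G" using G(1) \<open>finite S\<close> by (rule finite_subset)
  have "degree_le M g" if "g \<in> G" for g
    using that G(1) degree_le_monom[of _ M 1] by (auto simp: S_def)
  then have "card G \<le> M"
    unfolding M_def using card_independent_over_image_le[OF w f \<open>finite G\<close> _ G(2)] by blast
  define Q where "Q y = (\<Prod>s\<in>S. q s y)" for y
  show ?thesis
  proof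
    show "real_polynomial_function Q"
      unfolding Q_def [abs_def] using q(1) \<open>finite S\<close> by (intro real_polynomial_function_prod)
    show "\<exists>c. Q c \<noteq> 0"
      unfolding Q_def using real_polynomial_function_common_nonzero[OF \<open>finite S\<close> q(1,2)] \<open>finite S\<close>
      by auto
    fix c assume "Q c \<noteq> 0"
    then have qc: "q s c \<noteq> 0" if "s \<in> S" for s
      using that \<open>finite S\<close> by (auto simp: Q_def)
    show "finite {x. f x = c} \<and> card {x. f x = c} \<le> (\<Prod>j\<in>UNIV. w j)"
    proof (rule ccontr)
      assume "\<not> ?thesis"
      then have "\<exists>T. T \<subseteq> {x. f x = c} \<and> finite T \<and> card T = Suc M"
        by (metis M_def infinite_arbitrarily_large not_less_eq_eq obtain_subset_with_card_n)
      then obtain T where T: "\<And>x. x \<in> T \<Longrightarrow> f x = c" "finite T" "card T = Suc M"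
        by blast
      then have "card G < card T" using \<open>card G \<le> M\<close> by simp
      from homogeneous_system_nontrivial[OF \<open>finite G\<close> T(2) this, of "\<lambda>x g. g x"]
      obtain u p0 where u: "p0 \<in> T" "u p0 \<noteq> 0" "\<And>g. g \<in> G \<Longrightarrow> (\<Sum>p\<in>T. u p * g p) = 0"
        by blast
      \<comment> \<open>On the fibre over \<open>c\<close> the relations have constant coefficients,
        so a functional supported on \<open>T\<close> that kills \<open>G\<close> kills
        \<open>q s c\<close> times \<open>s\<close>, and \<open>q s c\<close> is nonzero.\<close>
      have S0: "(\<Sum>p\<in>T. u p * s p) = 0" if "s \<in> S" for s
      proof -
        have "q s c * (\<Sum>p\<in>T. u p * s p) = (\<Sum>p\<in>T. u p * (q s (f p) * s p))"
          unfolding sum_distrib_left by (intro sum.cong) (auto simp: T(1) mult_ac)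
        also have "\<dots> = (\<Sum>p\<in>T. \<Sum>g\<in>G. b s g c * (u p * g p))"
          unfolding q(3)[OF that] sum_distrib_left
          by (intro sum.cong) (auto simp: T(1) mult_ac)
        also have "\<dots> = (\<Sum>g\<in>G. \<Sum>p\<in>T. b s g c * (u p * g p))" by (rule sum.swap)
        also have "\<dots> = 0" by (simp add: u(3) flip: sum_distrib_left)
        finally show ?thesis using qc[OF that] by simp
      qed
      obtain h where h: "degree_le M h" "h p0 \<noteq> 0" "\<And>p. p \<in> T \<Longrightarrow> p \<noteq> p0 \<Longrightarrow> h p = 0"
        using degree_le_interpolant[OF T(2) u(1) T(3)] by blast
      then obtain k where k: "\<And>x. h x = (\<Sum>a\<in>exponents M. k a * monom_fun a x)"
        unfolding degree_le_def by blast
      \<comment> \<open>The interpolant isolates the weight at \<open>p0\<close>, while its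
        expansion in members of \<open>S\<close> makes the functional vanish on it.\<close>
      have "u p0 * h p0 = (\<Sum>p\<in>T. u p * h p)"
        using u(1) T(2) h(3) by (subst sum.remove[of T p0]) auto
      also have "\<dots> = (\<Sum>p\<in>T. \<Sum>a\<in>exponents M. k a * (u p * monom_fun a p))"
        unfolding k sum_distrib_left by (simp add: mult_ac)
      also have "\<dots> = (\<Sum>a\<in>exponents M. \<Sum>p\<in>T. k a * (u p * monom_fun a p))"
        by (rule sum.swap)
      also have "\<dots> = 0" by (simp add: S0 S_def flip: sum_distrib_left)
      finally show False using u(2) h(2) by simp
    qed
  qed
qed

section \<open>Coordinates on the parameter space\<close>

text \<open>The dimension of the space of symmetric matrices: singletons stand for diagonal entries,
  pairs for off-diagonal ones.\<close>

lemma card_doubleton_index_sets: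
  "card {S :: 'd::finite set. card S = 1 \<or> card S = 2} = CARD('d) + (CARD('d) choose 2)"
proof -
  have "{S :: 'd set. card S = 1 \<or> card S = 2} =
      {S. S \<subseteq> UNIV \<and> card S = 1} \<union> {S. S \<subseteq> UNIV \<and> card S = 2}" by auto
  then show ?thesis
    using n_subsets[of "UNIV :: 'd set" 1] n_subsets[of "UNIV :: 'd set" 2]
    by (simp add: card_Un_disjoint disjoint_iff)
qed

lemma card_doubleton: "card {k, l} = 1 \<or> card {k, l} = 2"
  by (cases "k = l") auto

text \<open>
  The entry of a symmetric matrix in row \<open>k\<close> and column \<open>l\<close> is indexed by the set \<open>{k, l}\<close>.
\<close>

definition parameter_indices :: "'n::finite \<Rightarrow> (('n \<times> 'd::finite) + 'd set) set" where
  "parameter_indices i0 = ((- {i0}) \<times> UNIV) <+> {S. card S = 1 \<or> card S = 2}"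

text \<open>Fixing the base vertex removes \<open>CARD('d)\<close> coordinates, and the diagonal
  entries of \<open>\<omega>\<close> restore the same number.\<close>

lemma card_parameter_indices:
  "card (parameter_indices (i0 :: 'n::finite) :: (('n \<times> 'd::finite) + 'd set) set) =
     CARD('d) * CARD('n) + (CARD('d) choose 2)"
proof -
  obtain n where n: "CARD('n) = Suc n" by (metis Suc_pred' zero_less_card_finite)
  then have "card (- {i0}) = n" by (simp add: Compl_eq_Diff_UNIV)
  then show ?thesis
    unfolding parameter_indices_def
    by (simp add: card_Plus card_cartesian_product n card_doubleton_index_sets[simplified])
qed

text \<open>\<open>\<beta>\<close> labels the free parameters by edge indices, so that the squared
  length map becomes a map from a coordinate space to itself.\<close>

definition parameter_point ::
  "'n::finite \<Rightarrow> (('n \<times> 'd::finite) + 'd set \<Rightarrow> 'm) \<Rightarrow> real ^ 'm::finite \<Rightarrow> ((real ^ 'd) ^ 'n) \<times> (real ^ 'd ^ 'd)"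
  where "parameter_point i0 \<beta> y =
    ((\<chi> i k. if i = i0 then 0 else y $ \<beta> (Inl (i, k))), (\<chi> k l. y $ \<beta> (Inr {k, l})))"

lemma parameter_point_surj:
  assumes \<beta>: "inj_on \<beta> (parameter_indices i0)" and z: "z \<in> parameter_tangent i0"
  shows "\<exists>y. z = parameter_point i0 \<beta> y"
proof -
  obtain t \<omega> where zt: "z = (t, \<omega>)" and t: "t $ i0 = 0" and \<omega>: "transpose \<omega> = \<omega>"
    using z by (auto simp: parameter_tangent_def)
  have sym: "\<omega> $ k $ l = \<omega> $ l $ k" for k l
    by (subst \<omega>[symmetric]) (simp add: transpose_def)
  define c where "c x = (case x of Inl (i, k) \<Rightarrow> t $ i $ k
    | Inr S \<Rightarrow> (THE r. \<exists>k l. S = {k, l} \<and> r = \<omega> $ k $ l))" for x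
  \<comment> \<open>The set \<open>{k, l}\<close> determines an entry only up to transposition;
    symmetry of \<open>\<omega>\<close> makes its value unique.\<close>
  have c_Inr: "c (Inr {k, l}) = \<omega> $ k $ l" for k l
    unfolding c_def sum.case by (rule the_equality) (auto simp: doubleton_eq_iff sym)
  define y where "y = (\<chi> j. c (inv_into (parameter_indices i0) \<beta> j))"
  have y: "y $ \<beta> x = c x" if "x \<in> parameter_indices i0" for x
    using that \<beta> by (simp add: y_def)
  have "t $ i $ k = y $ \<beta> (Inl (i, k))" if "i \<noteq> i0" for i k
    using that by (subst y) (auto simp: parameter_indices_def c_def)
  moreover have "\<omega> $ k $ l = y $ \<beta> (Inr {k, l})" for k l
    using card_doubleton[of k l] by (subst y) (auto simp: parameter_indices_def c_Inr)
  ultimately have "z = parameter_point i0 \<beta> y"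
    using t by (simp add: zt parameter_point_def vec_eq_iff)
  then show ?thesis by blast
qed

lemma squared_length_map_component:
  "squared_length_map src tgt sh (t, \<omega>) $ e =
    (\<Sum>k\<in>UNIV. \<Sum>l\<in>UNIV. edge_vector src tgt sh t e $ k * (\<omega> $ k $ l * edge_vector src tgt sh t e $ l))"
  by (simp add: squared_length_map_def inner_vec_def matrix_vector_mult_def sum_distrib_left)

text \<open>For a loop the two vertex positions cancel, the edge vector is constant and only
  \<open>\<omega>\<close> contributes. Otherwise the edge vector is affine in the parameters and
  occurs twice.\<close>

lemma degree_le_squared_length_map:
  "degree_le (if src e = tgt e then 1 else 3)
     (\<lambda>y. squared_length_map src tgt sh (parameter_point i0 \<beta> y) $ e)"
proof -
  define t where "t y = fst (parameter_point i0 \<beta> y)" for y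
  define \<omega> where "\<omega> y = snd (parameter_point i0 \<beta> y)" for y
  define D :: nat where "D = (if src e = tgt e then 0 else 1)"
  have t: "degree_le (Suc 0) (\<lambda>y. t y $ i $ k)" for i k
    using degree_le_coord[of "\<beta> (Inl (i, k))"] degree_le_const
    by (cases "i = i0") (simp_all add: t_def parameter_point_def)
  have \<omega>: "degree_le (Suc 0) (\<lambda>y. \<omega> y $ k $ l)" for k l
    using degree_le_coord[of "\<beta> (Inr {k, l})"] by (simp add: \<omega>_def parameter_point_def)
  have ev: "degree_le D (\<lambda>y. edge_vector src tgt sh (t y) e $ k)" for k
  proof (cases "src e = tgt e")
    case True
    then show ?thesis by (simp add: edge_vector_def D_def degree_le_const)
  next
    case False
    then have "D = Suc 0" by (simp add: D_def)
    then show ?thesis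
      by (simp only: edge_vector_def vector_add_component vector_minus_component vec_lambda_beta)
        (intro degree_le_diff degree_le_add degree_le_const t)
  qed
  have "degree_le (D + (Suc 0 + D)) (\<lambda>y. squared_length_map src tgt sh (t y, \<omega> y) $ e)"
    unfolding squared_length_map_component
    by (intro degree_le_sum degree_le_mult ev \<omega>)
  moreover have "D + (Suc 0 + D) = (if src e = tgt e then 1 else 3)" by (simp add: D_def)
  ultimately show ?thesis by (simp only: t_def \<omega>_def prod.collapse)
qed

section \<open>Differentiating the squared length map and counting loops\<close>

lemma polynomial_function_squared_length_map:
  "polynomial_function (squared_length_map src tgt sh)"
proof -
  have t: "real_polynomial_function (\<lambda>z. fst z $ i $ k)"
    and \<omega>: "real_polynomial_function (\<lambda>z. snd z $ k $ l)"
    for i k l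
    by (intro real_polynomial_function.intros(1) bounded_linear_compose[OF bounded_linear_vec_nth]
        bounded_linear_fst bounded_linear_snd)+
  have "real_polynomial_function (\<lambda>z. squared_length_map src tgt sh z $ e)" for e
  proof -
    have "real_polynomial_function (\<lambda>z. \<Sum>k\<in>UNIV. \<Sum>l\<in>UNIV. edge_vector src tgt sh (fst z) e $ k *
        (snd z $ k $ l * edge_vector src tgt sh (fst z) e $ l))"
      unfolding edge_vector_def vector_add_component vector_minus_component
      by (intro real_polynomial_function_sum finite real_polynomial_function.intros(2-4)
          real_polynomial_function_diff t \<omega>)
    then show ?thesis
      by (simp only: squared_length_map_component[symmetric] prod.collapse)
  qed
  then show ?thesis
    by (auto simp: polynomial_function_iff_Basis_inner Basis_vec_def cart_eq_inner_axis)
qed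

text \<open>A loop with shift \<open>n\<close> pairs \<open>\<omega>\<close> with the rank-one
  symmetric matrix of products of entries of \<open>n\<close>. Too many such matrices are linearly
  dependent, so a nonzero functional \<open>h\<close> annihilates the whole map and hence the image
  of its derivative, against full rank.\<close>

lemma card_loops_le:
  fixes src tgt :: "'m::finite \<Rightarrow> 'n::finite" and sh :: "'m \<Rightarrow> int ^ 'd::finite"
  assumes rank: "differential_rank i0 src tgt sh z = CARD('m)"
  shows "card {e. src e = tgt e} \<le> CARD('d) + (CARD('d) choose 2)"
proof (rule ccontr)
  let ?F = "squared_length_map src tgt sh"
  let ?L = "{e. src e = tgt e}"
  define n where "n e k = real_of_int (sh e $ k)" for e k
  assume "\<not> ?thesis"
  then have card: "card {S :: 'd set. card S = 1 \<or> card S = 2} < card ?L"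
    by (simp only: card_doubleton_index_sets not_le)
  \<comment> \<open>The entry at \<open>{k, l}\<close> of that rank-one matrix; a singleton needs
    the square because its product has a single factor.\<close>
  define c where "c e S = (if card S = 1 then \<Prod>k\<in>S. n e k ^ 2 else \<Prod>k\<in>S. n e k)" for e S
  from homogeneous_system_nontrivial[OF finite finite card, of c]
  obtain u e0 where e0: "e0 \<in> ?L" "u e0 \<noteq> 0"
    and u: "\<And>S. S \<in> {S. card S = 1 \<or> card S = 2} \<Longrightarrow> (\<Sum>e\<in>?L. u e * c e S) = 0"
    by blast
  have nn: "(\<Sum>e\<in>?L. u e * (n e k * n e l)) = 0" for k l
  proof -
    have "c e {k, l} = n e k * n e l" for e
      by (cases "k = l") (simp_all add: c_def power2_eq_square)
    then show ?thesis using u[of "{k, l}"] card_doubleton[of k l] by simp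
  qed
  define h where "h y = (\<Sum>e\<in>?L. u e * y $ e)" for y :: "real ^ 'm"
  have "h (?F (t, \<omega>)) = 0" for t \<omega>
  proof -
    have "?F (t, \<omega>) $ e = (\<Sum>k\<in>UNIV. \<Sum>l\<in>UNIV. \<omega> $ k $ l * (n e k * n e l))" if "e \<in> ?L" for e
      using that unfolding squared_length_map_component by (simp add: edge_vector_def n_def mult_ac)
    then have "h (?F (t, \<omega>)) =
        (\<Sum>e\<in>?L. \<Sum>k\<in>UNIV. \<Sum>l\<in>UNIV. \<omega> $ k $ l * (u e * (n e k * n e l)))"
      unfolding h_def by (simp add: sum_distrib_left mult.left_commute)
    also have "\<dots> = (\<Sum>k\<in>UNIV. \<Sum>e\<in>?L. \<Sum>l\<in>UNIV. \<omega> $ k $ l * (u e * (n e k * n e l)))"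
      by (rule sum.swap)
    also have "\<dots> = (\<Sum>k\<in>UNIV. \<Sum>l\<in>UNIV. \<Sum>e\<in>?L. \<omega> $ k $ l * (u e * (n e k * n e l)))"
      by (intro sum.cong refl sum.swap)
    also have "\<dots> = 0" by (simp add: nn flip: sum_distrib_left)
    finally show ?thesis .
  qed
  then have hF: "(\<lambda>z. h (?F z)) = (\<lambda>z. 0)" by auto
  have h: "linear h"
    by (rule linearI) (simp_all add: h_def sum.distrib distrib_left sum_distrib_left mult.left_commute)
  let ?D = "frechet_derivative ?F (at z)"
  have D: "(?F has_derivative ?D) (at z)"
    using differentiable_at_polynomial_function[OF polynomial_function_squared_length_map]
    by (simp add: frechet_derivative_works)
  have "bounded_linear h" using h by (simp add: linear_conv_bounded_linear)
  from bounded_linear.has_derivative[OF this D]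
  have "((\<lambda>z. h (?F z)) has_derivative (\<lambda>x. h (?D x))) (at z)" .
  then have "(\<lambda>x. h (?D x)) = (\<lambda>x. 0)"
    unfolding hF by (rule has_derivative_unique) (rule has_derivative_const)
  then have "h (?D x) = 0" for x by (rule fun_cong)
  then have "?D ` parameter_tangent i0 \<subseteq> {y. h y = 0}" by blast
  then have "span (?D ` parameter_tangent i0) \<subseteq> {y. h y = 0}"
    using linear_subspace_kernel[OF h] by (simp add: span_minimal)
  moreover have "span (?D ` parameter_tangent i0) = UNIV"
    using rank by (simp add: differential_rank_def flip: dim_eq_full)
  ultimately have "h (axis e0 1) = 0" by auto
  then show False
    using e0 by (simp add: h_def axis_def if_distrib cong: if_cong)
qed

text \<open>The fibre in the parameter space lies in the image of the fibre over all symmetric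
  \<open>\<omega>\<close>; restricting to positive definite ones can only discard points. Each
  non-loop contributes a factor 3 and each loop a factor 1.\<close>

lemma generic_parameter_fibre_card_le:
  fixes src tgt :: "'m::finite \<Rightarrow> 'n::finite" and sh :: "'m \<Rightarrow> int ^ 'd::finite"
  assumes m: "CARD('m) = CARD('d) * CARD('n) + (CARD('d) choose 2)"
  obtains Q where "real_polynomial_function Q" "\<exists>c. Q c \<noteq> 0"
    "\<And>c. Q c \<noteq> 0 \<Longrightarrow>
      finite {z \<in> parameter_space i0. squared_length_map src tgt sh z = c} \<and>
      card {z \<in> parameter_space i0. squared_length_map src tgt sh z = c} \<le> 3 ^ num_cubic src tgt"
proof -
  let ?I = "parameter_indices i0 :: (('n \<times> 'd) + 'd set) set"
  let ?w = "\<lambda>e. if src e = tgt e then 1 else 3 :: nat"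
  have "card ?I = card (UNIV :: 'm set)" by (simp add: card_parameter_indices m)
  then obtain \<beta> :: "('n \<times> 'd) + 'd set \<Rightarrow> 'm" where "bij_betw \<beta> ?I UNIV"
    using finite_same_card_bij[of ?I "UNIV :: 'm set"] by auto
  then have \<beta>: "inj_on \<beta> ?I" by (simp add: bij_betw_def)
  let ?p = "parameter_point i0 \<beta>"
  let ?f = "\<lambda>y. squared_length_map src tgt sh (?p y)"
  have w_pos: "?w e > 0" for e by simp
  have deg: "degree_le (?w e) (\<lambda>y. ?f y $ e)" for e by (rule degree_le_squared_length_map)
  obtain Q where Q: "real_polynomial_function Q" "\<exists>c. Q c \<noteq> 0"
    "\<And>c. Q c \<noteq> 0 \<Longrightarrow> finite {y. ?f y = c} \<and> card {y. ?f y = c} \<le> (\<Prod>e\<in>UNIV. ?w e)"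
    using generic_fibre_card_le[of ?w ?f, OF w_pos deg] by blast
  have "(\<Prod>e\<in>UNIV. ?w e) = (\<Prod>e\<in>{e. src e \<noteq> tgt e}. 3)"
    by (intro prod.mono_neutral_cong_right) auto
  then have w: "(\<Prod>e\<in>UNIV. ?w e) = 3 ^ num_cubic src tgt" by (simp add: num_cubic_def)
  have sub: "{z \<in> parameter_space i0. squared_length_map src tgt sh z = c} \<subseteq> ?p ` {y. ?f y = c}" for c
  proof
    fix z assume z: "z \<in> {z \<in> parameter_space i0. squared_length_map src tgt sh z = c}"
    then have "z \<in> parameter_tangent i0"
      by (auto simp: parameter_space_def parameter_tangent_def positive_definite_def)
    then show "z \<in> ?p ` {y. ?f y = c}" using parameter_point_surj[OF \<beta>] z by blast
  qed
  show ?thesis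
  proof (rule that[OF Q(1,2)])
    fix c assume "Q c \<noteq> 0"
    with Q(3) have fin: "finite {y. ?f y = c}" and card: "card {y. ?f y = c} \<le> 3 ^ num_cubic src tgt"
      unfolding w by blast+
    show "finite {z \<in> parameter_space i0. squared_length_map src tgt sh z = c} \<and>
      card {z \<in> parameter_space i0. squared_length_map src tgt sh z = c} \<le> 3 ^ num_cubic src tgt"
      using finite_subset[OF sub] surj_card_le[OF fin sub] fin card by force
  qed
qed

section \<open>Congruence classes and parameters\<close>

text \<open>A value of \<open>f\<close> determines the class, through a chosen representative in
  \<open>A\<close> with that value. Symmetry and transitivity are the form in which
  \<open>congruence\<close> enters, as it is reflexive on placements alone.\<close>

lemma card_quotient_le:
  assumes sym: "sym r" and trans: "trans r"
    and f: "f ` A \<subseteq> F" "\<And>x y. x \<in> A \<Longrightarrow> y \<in> A \<Longrightarrow> f x = f y \<Longrightarrow> (x, y) \<in> r"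
    and F: "finite F"
  shows "finite (A // r) \<and> card (A // r) \<le> card F"
proof -
  define g where "g z = r `` {SOME x. x \<in> A \<and> f x = z}" for z
  have "r `` {x} = g (f x)" if "x \<in> A" for x
  proof -
    have "(SOME y. y \<in> A \<and> f y = f x) \<in> A \<and> f (SOME y. y \<in> A \<and> f y = f x) = f x"
      by (rule someI[of "\<lambda>y. y \<in> A \<and> f y = f x" x]) (simp add: that)
    with f(2) that have "(x, SOME y. y \<in> A \<and> f y = f x) \<in> r" by metis
    then show ?thesis unfolding g_def using symD[OF sym] transD[OF trans] by blast
  qed
  then have "A // r \<subseteq> g ` F" using f(1) by (auto simp: quotient_def)
  then show ?thesis using F by (meson finite_surj surj_card_le)
qed

lemma sym_congruence: "sym (congruence V \<Gamma>)"
proof (rule symI)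
  fix P P' :: "('a \<Rightarrow> real ^ 'b) \<times> (('a \<Rightarrow> 'a) \<Rightarrow> real ^ 'b)"
  obtain p \<pi> p' \<pi>' where P: "P = (p, \<pi>)" "P' = (p', \<pi>')" by (metis surj_pair)
  assume "(P, P') \<in> congruence V \<Gamma>"
  then obtain U t where pl: "P \<in> periodic_placements V \<Gamma>" "P' \<in> periodic_placements V \<Gamma>"
    and U: "orthogonal_matrix U" "\<And>x. x \<in> V \<Longrightarrow> p' x = U *v p x + t"
      "\<And>g. g \<in> \<Gamma> \<Longrightarrow> \<pi>' g = U *v \<pi> g"
    unfolding P congruence_def by auto
  define W where "W = transpose U"
  have inv: "W *v (U *v x) = x" for x
    using U(1) by (simp add: W_def orthogonal_matrix_def matrix_vector_mul_assoc)
  have "orthogonal_matrix W" using U(1) by (simp add: W_def orthogonal_matrix_transpose)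
  moreover have "\<forall>x\<in>V. p x = W *v p' x + - (W *v t)"
    by (simp add: U(2) matrix_vector_right_distrib inv)
  moreover have "\<forall>g\<in>\<Gamma>. \<pi> g = W *v \<pi>' g" by (simp add: U(3) inv)
  ultimately show "(P', P) \<in> congruence V \<Gamma>"
    using pl unfolding P congruence_def by blast
qed

lemma trans_congruence: "trans (congruence V \<Gamma>)"
proof (rule transI)
  fix P P' P'' :: "('a \<Rightarrow> real ^ 'b) \<times> (('a \<Rightarrow> 'a) \<Rightarrow> real ^ 'b)"
  obtain p \<pi> p' \<pi>' p'' \<pi>'' where P: "P = (p, \<pi>)" "P' = (p', \<pi>')" "P'' = (p'', \<pi>'')"
    by (metis surj_pair)
  assume "(P, P') \<in> congruence V \<Gamma>" "(P', P'') \<in> congruence V \<Gamma>"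
  then obtain U t U' t' where pl: "P \<in> periodic_placements V \<Gamma>" "P'' \<in> periodic_placements V \<Gamma>"
    and U: "orthogonal_matrix U" "\<And>x. x \<in> V \<Longrightarrow> p' x = U *v p x + t"
      "\<And>g. g \<in> \<Gamma> \<Longrightarrow> \<pi>' g = U *v \<pi> g"
    and U': "orthogonal_matrix U'" "\<And>x. x \<in> V \<Longrightarrow> p'' x = U' *v p' x + t'"
      "\<And>g. g \<in> \<Gamma> \<Longrightarrow> \<pi>'' g = U' *v \<pi>' g"
    unfolding P congruence_def by auto
  have "orthogonal_matrix (U' ** U)" using U(1) U'(1) by (rule orthogonal_matrix_mul[rotated])
  moreover have "\<forall>x\<in>V. p'' x = (U' ** U) *v p x + (U' *v t + t')"
    by (simp add: U U' matrix_vector_right_distrib matrix_vector_mul_assoc add.assoc)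
  moreover have "\<forall>g\<in>\<Gamma>. \<pi>'' g = (U' ** U) *v \<pi> g"
    by (simp add: U U' matrix_vector_mul_assoc)
  ultimately show "(P, P'') \<in> congruence V \<Gamma>"
    using pl unfolding P congruence_def by blast
qed

section \<open>Lattice matrices and the parameters of a placement\<close>

lemma matrix_inv_inverse:
  "invertible A \<Longrightarrow> A ** matrix_inv A = mat 1 \<and> matrix_inv A ** A = mat 1"
  unfolding invertible_def matrix_inv_def by (rule someI_ex)

definition real_vec :: "int ^ 'd \<Rightarrow> real ^ 'd::finite" where
  "real_vec a = (\<chi> k. of_int (a $ k))"

text \<open>Additivity carries the values on unit vectors first to natural multiples, then to
  integer multiples and finally to all integer vectors.\<close>

lemma additive_int_vec_eq_matrix:
  fixes h :: "int ^ 'd::finite \<Rightarrow> real ^ 'd"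
  assumes add: "\<And>a b. h (a + b) = h a + h b"
  shows "h a = (\<chi> r k. h (axis k 1) $ r) *v real_vec a"
proof -
  interpret additive h by unfold_locales (rule add)
  have nat: "h (axis k (int m)) = real m *\<^sub>R h (axis k 1)" for k m
  proof (induction m)
    case 0
    have "axis k (int 0) = (0 :: int ^ 'd)" by (simp add: axis_def vec_eq_iff)
    then show ?case by (simp only: zero) simp
  next
    case (Suc m)
    have "axis k (int (Suc m)) = axis k (int m) + axis k 1"
      by (simp add: axis_def vec_eq_iff)
    then show ?case using Suc by (simp add: add scaleR_left_distrib)
  qed
  have int: "h (axis k m) = of_int m *\<^sub>R h (axis k 1)" for k m
  proof (cases m)
    case (neg n)
    have "axis k m = - axis k (int (Suc n))" by (simp add: axis_def vec_eq_iff neg)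
    then have "h (axis k m) = - (real (Suc n) *\<^sub>R h (axis k 1))" by (simp only: minus nat)
    also have "\<dots> = of_int m *\<^sub>R h (axis k 1)" unfolding neg by (simp only: of_int_minus of_int_of_nat_eq scaleR_minus_left)
    finally show ?thesis .
  qed (simp add: nat)
  have "a = (\<Sum>k\<in>UNIV. axis k (a $ k))"
    by (simp add: vec_eq_iff axis_def if_distrib cong: if_cong)
  then have "h a = (\<Sum>k\<in>UNIV. h (axis k (a $ k)))" by (metis sum)
  also have "\<dots> = (\<Sum>k\<in>UNIV. of_int (a $ k) *\<^sub>R h (axis k 1))" by (intro sum.cong refl int)
  finally show ?thesis
    by (simp add: vec_eq_iff matrix_vector_mult_def real_vec_def mult.commute)
qed

locale coordinatized_periodic_graph =
  fixes V :: "'v set" and \<Gamma> :: "('v \<Rightarrow> 'v) set" and \<phi> :: "int ^ 'd::finite \<Rightarrow> 'v \<Rightarrow> 'v"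
    and v :: "'n::finite \<Rightarrow> 'v"
  assumes subgroup: "subgroup \<Gamma> (BijGroup V)"
    and coordinates: "lattice_coordinates V \<Gamma> \<phi>"
    and representatives: "vertex_representatives V \<Gamma> v"
begin

lemma carrier_perm_group [simp]: "carrier (perm_group V \<Gamma>) = \<Gamma>"
  by (simp add: perm_group_def)

lemma range_\<phi>: "range \<phi> = \<Gamma>"
  using coordinates
  by (auto simp: lattice_coordinates_def iso_def bij_betw_def additive_group_def)

lemma \<phi>_add: "\<phi> (a + b) = \<phi> a \<otimes>\<^bsub>perm_group V \<Gamma>\<^esub> \<phi> b"
  using coordinates
  by (auto simp: lattice_coordinates_def iso_def hom_def additive_group_def)

lemma v_in_V: "v i \<in> V"
  using representatives by (auto simp: vertex_representatives_def)

lemma vertex_eq_translate: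
  assumes "x \<in> V"
  obtains i a where "x = \<phi> a (v i)"
proof -
  let ?orb = "orbit (perm_group V \<Gamma>) (\<lambda>g. g)"
  have "?orb x \<in> vertex_orbits V \<Gamma>"
    using assms by (auto simp: vertex_orbits_def orbits_def)
  also have "vertex_orbits V \<Gamma> = range (\<lambda>i. ?orb (v i))"
    using representatives by (simp add: vertex_representatives_def bij_betw_def)
  finally obtain i where i: "?orb x = ?orb (v i)" by (rule rangeE)
  have "\<one>\<^bsub>BijGroup V\<^esub> x = x" using assms by (simp add: BijGroup_def)
  then have "x \<in> ?orb x"
    using subgroup.one_closed[OF subgroup]
    by (auto simp: orbit_def intro!: exI[of _ "\<one>\<^bsub>BijGroup V\<^esub>"])
  then obtain g where "g \<in> \<Gamma>" "x = g (v i)" unfolding i by (auto simp: orbit_def)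
  then show ?thesis using range_\<phi> that by blast
qed

lemma card_vertex_orbits: "card (vertex_orbits V \<Gamma>) = CARD('n)"
  using representatives by (auto simp: vertex_representatives_def dest!: bij_betw_same_card)

text \<open>The matrix \<open>\<Lambda>\<close> whose columns are the translations of the standard
  generators.\<close>

definition lattice_matrix :: "(('v \<Rightarrow> 'v) \<Rightarrow> real ^ 'd) \<Rightarrow> real ^ 'd ^ 'd" where
  "lattice_matrix \<pi> = (\<chi> r k. \<pi> (\<phi> (axis k 1)) $ r)"

definition placement_parameters ::
  "'n \<Rightarrow> ('v \<Rightarrow> real ^ 'd) \<times> (('v \<Rightarrow> 'v) \<Rightarrow> real ^ 'd) \<Rightarrow> ((real ^ 'd) ^ 'n) \<times> (real ^ 'd ^ 'd)"
  where "placement_parameters i0 = (\<lambda>(p, \<pi>).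
    (\<chi> i. matrix_inv (lattice_matrix \<pi>) *v (p (v i) - p (v i0)),
     transpose (lattice_matrix \<pi>) ** lattice_matrix \<pi>))"

lemma \<pi>_\<phi>:
  assumes "(p, \<pi>) \<in> periodic_placements V \<Gamma>"
  shows "\<pi> (\<phi> a) = lattice_matrix \<pi> *v real_vec a"
proof -
  have "\<pi> \<in> hom (perm_group V \<Gamma>) additive_group"
    using assms by (simp add: periodic_placements_def)
  from hom_mult[OF this] have "\<pi> (\<phi> (a + b)) = \<pi> (\<phi> a) + \<pi> (\<phi> b)" for a b
    unfolding \<phi>_add using rangeI[of \<phi>, unfolded range_\<phi>] by (simp add: additive_group_def)
  from additive_int_vec_eq_matrix[of "\<lambda>a. \<pi> (\<phi> a)", OF this] show ?thesis
    unfolding lattice_matrix_def .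
qed

text \<open>The lattice basis \<open>b\<close> consists of translations of group elements, so it
  lies in the range of the matrix, which is therefore the whole space.\<close>

lemma invertible_lattice_matrix:
  assumes "(p, \<pi>) \<in> periodic_placements V \<Gamma>"
  shows "invertible (lattice_matrix \<pi>)"
proof -
  let ?L = "lattice_matrix \<pi>"
  have "full_rank_lattice (\<pi> ` \<Gamma>)" using assms by (simp add: periodic_placements_def)
  then obtain b :: "'d \<Rightarrow> real ^ 'd" where b: "inj b" "independent (range b)"
    "\<pi> ` \<Gamma> = range (\<lambda>a :: 'd \<Rightarrow> int. \<Sum>k\<in>UNIV. of_int (a k) *\<^sub>R b k)"
    unfolding full_rank_lattice_def by blast
  have "b l \<in> range ((*v) ?L)" for l
  proof -
    have "b l = (\<Sum>k\<in>UNIV. of_int (if k = l then 1 else 0) *\<^sub>R b k)"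
      by (simp add: if_distrib if_distribR cong: if_cong)
    then have "b l \<in> \<pi> ` \<Gamma>"
      unfolding b(3) by (intro image_eqI[of _ _ "\<lambda>k. if k = l then 1 else 0"]) auto
    then show ?thesis using \<pi>_\<phi>[OF assms] range_\<phi> by auto
  qed
  then have "span (range b) \<subseteq> range ((*v) ?L)"
    by (intro span_minimal linear_subspace_image matrix_vector_mul_linear subspace_UNIV) auto
  moreover have "span (range b) = UNIV"
    using b by (simp add: dim_eq_full[symmetric] dim_eq_card_independent card_image)
  ultimately have "surj ((*v) ?L)" by auto
  then show ?thesis
    by (simp add: invertible_right_inverse matrix_right_invertible_surjective)
qed

text \<open>Every vertex is a translate of a representative, so this recovers the placement from the
  base position, the lattice matrix and \<open>t\<close>.\<close>

lemma placement_eq: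
  assumes P: "(p, \<pi>) \<in> periodic_placements V \<Gamma>"
    and t: "placement_parameters i0 (p, \<pi>) = (t, \<omega>)"
  shows "p (\<phi> a (v i)) = p (v i0) + lattice_matrix \<pi> *v (t $ i + real_vec a)"
proof -
  let ?L = "lattice_matrix \<pi>"
  have "?L ** matrix_inv ?L = mat 1"
    using invertible_lattice_matrix[OF P] by (simp add: matrix_inv_inverse)
  moreover have "t $ i = matrix_inv ?L *v (p (v i) - p (v i0))"
    using t by (auto simp: placement_parameters_def)
  ultimately have "?L *v t $ i = p (v i) - p (v i0)"
    by (simp add: matrix_vector_mul_assoc)
  moreover have "p (\<phi> a (v i)) = p (v i) + \<pi> (\<phi> a)"
    using P v_in_V range_\<phi> by (auto simp: periodic_placements_def)
  ultimately show ?thesis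
    by (simp add: \<pi>_\<phi>[OF P] matrix_vector_right_distrib)
qed

lemma inner_gram: "x \<bullet> ((transpose A ** A) *v y) = (A *v x) \<bullet> (A *v y)"
  for A :: "real ^ 'd ^ 'd"
proof -
  have "x \<bullet> ((transpose A ** A) *v y) = x \<bullet> ((A *v y) v* A)"
    by (simp flip: matrix_vector_mul_assoc)
  also have "\<dots> = (A *v y) \<bullet> (A *v x)" by (simp only: inner_commute[of x] dot_lmul_matrix)
  finally show ?thesis by (simp only: inner_commute)
qed

lemma placement_parameters_in_space:
  assumes P: "(p, \<pi>) \<in> periodic_placements V \<Gamma>"
  shows "placement_parameters i0 (p, \<pi>) \<in> parameter_space i0"
proof -
  let ?L = "lattice_matrix \<pi>"
  have "?L *v x \<noteq> 0" if "x \<noteq> 0" for x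
  proof
    have "matrix_inv ?L ** ?L = mat 1"
      using invertible_lattice_matrix[OF P] by (simp add: matrix_inv_inverse)
    then have "matrix_inv ?L *v (?L *v x) = x" by (simp add: matrix_vector_mul_assoc)
    moreover assume "?L *v x = 0"
    ultimately show False using that by simp
  qed
  then have "positive_definite (transpose ?L ** ?L)"
    by (simp add: positive_definite_def inner_gram matrix_transpose_mul)
  then show ?thesis by (simp add: placement_parameters_def parameter_space_def)
qed

text \<open>The lattice matrix carries the edge vector in lattice coordinates to the actual edge,
  and its Gram matrix \<open>\<omega>\<close> measures the length.\<close>

lemma squared_length_map_placement_parameters:
  assumes P: "(p, \<pi>) \<in> periodic_placements V \<Gamma>"
  shows "squared_length_map src tgt sh (placement_parameters i0 (p, \<pi>)) = squared_lengths \<phi> v src tgt sh p"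
proof -
  let ?L = "lattice_matrix \<pi>"
  obtain t \<omega> where t: "placement_parameters i0 (p, \<pi>) = (t, \<omega>)" by (metis surj_pair)
  then have \<omega>: "\<omega> = transpose ?L ** ?L" by (simp add: placement_parameters_def)
  have pv: "p (v j) = p (v i0) + ?L *v t $ j" for j
  proof -
    have "p (\<phi> 0 (v j)) = p (v j) + \<pi> (\<phi> 0)"
      using P v_in_V range_\<phi> by (auto simp: periodic_placements_def)
    moreover have rv0: "real_vec 0 = 0" by (simp add: real_vec_def vec_eq_iff)
    ultimately show ?thesis
      using placement_eq[OF P t, of 0 j] by (simp add: \<pi>_\<phi>[OF P, of 0] rv0)
  qed
  have ev: "p (\<phi> (sh e) (v (tgt e))) - p (v (src e)) = ?L *v edge_vector src tgt sh t e" for e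
    by (simp add: placement_eq[OF P t] pv[of "src e"] edge_vector_def real_vec_def
        matrix_vector_right_distrib matrix_vector_mult_diff_distrib)
  show ?thesis
    unfolding t
    by (simp add: squared_length_map_def squared_lengths_def \<omega> inner_gram power2_norm_eq_inner ev)
qed

text \<open>Equal Gram matrices differ by an orthogonal factor on the left. Equal \<open>t\<close>
  then makes this factor, followed by the translation matching the base vertices, carry one
  placement to the other.\<close>

lemma congruent_if_same_parameters:
  assumes P: "(p, \<pi>) \<in> periodic_placements V \<Gamma>" and P': "(p', \<pi>') \<in> periodic_placements V \<Gamma>"
    and eq: "placement_parameters i0 (p, \<pi>) = placement_parameters i0 (p', \<pi>')"
  shows "((p, \<pi>), (p', \<pi>')) \<in> congruence V \<Gamma>"
proof -
  let ?L = "lattice_matrix \<pi>" and ?L' = "lattice_matrix \<pi>'"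
  obtain t \<omega> where t: "placement_parameters i0 (p, \<pi>) = (t, \<omega>)" by (metis surj_pair)
  have gram: "transpose ?L' ** ?L' = transpose ?L ** ?L"
    using eq by (simp add: placement_parameters_def)
  define U where "U = ?L' ** matrix_inv ?L"
  have inv: "matrix_inv ?L ** ?L = mat 1" "?L ** matrix_inv ?L = mat 1"
    using matrix_inv_inverse[OF invertible_lattice_matrix[OF P]] by auto
  then have "U ** ?L = ?L'" by (simp add: U_def flip: matrix_mul_assoc)
  then have UL: "U *v (?L *v x) = ?L' *v x" for x by (simp add: matrix_vector_mul_assoc)
  have "transpose U ** U = transpose (matrix_inv ?L) ** (transpose ?L' ** ?L') ** matrix_inv ?L"
    by (simp add: U_def matrix_transpose_mul matrix_mul_assoc)
  also have "\<dots> = transpose (?L ** matrix_inv ?L) ** (?L ** matrix_inv ?L)"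
    unfolding gram by (simp add: matrix_transpose_mul matrix_mul_assoc)
  also have "\<dots> = mat 1" by (simp add: inv)
  finally have "orthogonal_matrix U" by (simp add: orthogonal_matrix)
  moreover have "p' x = U *v p x + (p' (v i0) - U *v p (v i0))" if x: "x \<in> V" for x
  proof -
    obtain i a where "x = \<phi> a (v i)" using vertex_eq_translate[OF x] .
    then show ?thesis
      using placement_eq[OF P t, of a i] placement_eq[OF P' t[unfolded eq], of a i]
      by (simp add: matrix_vector_right_distrib UL)
  qed
  moreover have "\<pi>' g = U *v \<pi> g" if "g \<in> \<Gamma>" for g
    using that range_\<phi> by (auto simp: \<pi>_\<phi>[OF P] \<pi>_\<phi>[OF P'] UL)
  ultimately show ?thesis using P P' unfolding congruence_def by blast
qed

lemma card_congruence_classes_le: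
  assumes fin: "finite {z \<in> parameter_space i0. squared_length_map src tgt sh z = c}"
  shows "finite (placements_with_lengths V \<Gamma> \<phi> v src tgt sh c // congruence V \<Gamma>) \<and>
    card (placements_with_lengths V \<Gamma> \<phi> v src tgt sh c // congruence V \<Gamma>) \<le> card {z \<in> parameter_space i0. squared_length_map src tgt sh z = c}"
proof (rule card_quotient_le[OF sym_congruence trans_congruence _ _ fin])
  show "placement_parameters i0 ` placements_with_lengths V \<Gamma> \<phi> v src tgt sh c
    \<subseteq> {z \<in> parameter_space i0. squared_length_map src tgt sh z = c}"
    by (auto simp: placements_with_lengths_def placement_parameters_in_space
        squared_length_map_placement_parameters)
  show "(P, P') \<in> congruence V \<Gamma>"
    if "P \<in> placements_with_lengths V \<Gamma> \<phi> v src tgt sh c"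
      "P' \<in> placements_with_lengths V \<Gamma> \<phi> v src tgt sh c"
      "placement_parameters i0 P = placement_parameters i0 P'" for P P'
    using that congruent_if_same_parameters
    by (cases P; cases P') (auto simp: placements_with_lengths_def)
qed

end

theorem proposition3:
  fixes V :: "'v set" and E :: "'v set set" and \<Gamma> :: "('v \<Rightarrow> 'v) set"
    and \<phi> :: "int ^ 'd::finite \<Rightarrow> 'v \<Rightarrow> 'v"
    and v :: "'n::finite \<Rightarrow> 'v" and i0 :: 'n
    and src tgt :: "'m::finite \<Rightarrow> 'n" and sh :: "'m \<Rightarrow> int ^ 'd"
  assumes "periodic_graph CARD('d) V E \<Gamma>"
    and "lattice_coordinates V \<Gamma> \<phi>"
    and "vertex_representatives V \<Gamma> v"
    and "edge_representatives V E \<Gamma> \<phi> v src tgt sh"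
    and "minimally_rigid V E \<Gamma> i0 src tgt sh"
  shows "CARD('d) * card (vertex_orbits V \<Gamma>) - CARD('d) \<le> num_cubic src tgt \<and>
         num_cubic src tgt \<le> card (edge_orbits V E \<Gamma>) \<and>
         generically_on (UNIV :: (real ^ 'm) set)
           (\<lambda>c. finite (placements_with_lengths V \<Gamma> \<phi> v src tgt sh c // congruence V \<Gamma>) \<and>
                card (placements_with_lengths V \<Gamma> \<phi> v src tgt sh c // congruence V \<Gamma>)
                  \<le> 3 ^ num_cubic src tgt \<and>
                finite {z \<in> parameter_space i0. squared_length_map src tgt sh z = c} \<and>
                card {z \<in> parameter_space i0. squared_length_map src tgt sh z = c}
                  \<le> 3 ^ num_cubic src tgt)"
proof (intro conjI)
  interpret coordinatized_periodic_graph V \<Gamma> \<phi> v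
    using assms(1-3) by (intro coordinatized_periodic_graph.intro) (simp_all add: periodic_graph_def)
  have n: "card (vertex_orbits V \<Gamma>) = CARD('n)" by (rule card_vertex_orbits)
  have m: "card (edge_orbits V E \<Gamma>) = CARD('m)"
    using assms(4) by (auto simp: edge_representatives_def dest!: bij_betw_same_card)
  have mn: "CARD('m) = CARD('d) * CARD('n) + (CARD('d) choose 2)"
    using assms(5) by (simp add: minimally_rigid_def m n)
  \<comment> \<open>Genericity yields some point of full rank, and a single one bounds the number of
    loops.\<close>
  obtain z where "differential_rank i0 src tgt sh z = CARD('m)"
    using assms(5) unfolding minimally_rigid_def generically_on_def m by blast
  then have "card {e. src e = tgt e} \<le> CARD('d) + (CARD('d) choose 2)"
    by (rule card_loops_le)
  moreover have "{e. src e = tgt e} = - {e. src e \<noteq> tgt e}" by auto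
  then have "card {e. src e = tgt e} = CARD('m) - num_cubic src tgt"
    by (simp add: num_cubic_def card_Diff_subset Compl_eq_Diff_UNIV)
  moreover have le: "num_cubic src tgt \<le> CARD('m)"
    unfolding num_cubic_def by (rule card_mono) auto
  \<comment> \<open>Removing at most \<open>CARD('d) + (CARD('d) choose 2)\<close> loops from all
    edge orbits leaves the bound; as \<open>'n\<close> is nonempty, the subtraction in it is not
    truncated.\<close>
  ultimately show "CARD('d) * card (vertex_orbits V \<Gamma>) - CARD('d) \<le> num_cubic src tgt"
    unfolding n using mn by linarith
  show "num_cubic src tgt \<le> card (edge_orbits V E \<Gamma>)" using le m by simp
  obtain Q where Q: "real_polynomial_function Q" "\<exists>c. Q c \<noteq> 0"
    "\<And>c. Q c \<noteq> 0 \<Longrightarrow>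
      finite {z \<in> parameter_space i0. squared_length_map src tgt sh z = c} \<and>
      card {z \<in> parameter_space i0. squared_length_map src tgt sh z = c} \<le> 3 ^ num_cubic src tgt"
    using generic_parameter_fibre_card_le[of i0 src tgt sh, OF mn]
    by blast
  show "generically_on (UNIV :: (real ^ 'm) set)
           (\<lambda>c. finite (placements_with_lengths V \<Gamma> \<phi> v src tgt sh c // congruence V \<Gamma>) \<and>
                card (placements_with_lengths V \<Gamma> \<phi> v src tgt sh c // congruence V \<Gamma>)
                  \<le> 3 ^ num_cubic src tgt \<and>
                finite {z \<in> parameter_space i0. squared_length_map src tgt sh z = c} \<and>
                card {z \<in> parameter_space i0. squared_length_map src tgt sh z = c}
                  \<le> 3 ^ num_cubic src tgt)"
    unfolding generically_on_def
  \<comment> \<open>The zero set of \<open>Q\<close> is the exceptional set for the fibres and for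
    the congruence classes at once.\<close>
  proof (intro exI[of _ "{c. Q c = 0}"] conjI ballI)
    show "algebraic_set {c. Q c = 0}"
      unfolding algebraic_set_def using Q(1) by (intro exI[of _ "{Q}"]) simp
    show "\<not> UNIV \<subseteq> {c. Q c = 0}" using Q(2) by blast
    fix c assume "c \<in> UNIV - {c. Q c = 0}"
    then have fibre: "finite {z \<in> parameter_space i0. squared_length_map src tgt sh z = c}"
      "card {z \<in> parameter_space i0. squared_length_map src tgt sh z = c} \<le> 3 ^ num_cubic src tgt"
      using Q(3) by blast+
    note classes = card_congruence_classes_le[OF fibre(1)]
    show "finite {z \<in> parameter_space i0. squared_length_map src tgt sh z = c}"
      "card {z \<in> parameter_space i0. squared_length_map src tgt sh z = c} \<le> 3 ^ num_cubic src tgt"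
      by (fact fibre)+
    show "finite (placements_with_lengths V \<Gamma> \<phi> v src tgt sh c // congruence V \<Gamma>)"
      using classes by blast
    show "card (placements_with_lengths V \<Gamma> \<phi> v src tgt sh c // congruence V \<Gamma>)
      \<le> 3 ^ num_cubic src tgt"
      using classes fibre(2) by linarith
  qed
qed

end
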